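(* Let $n\geq 0$ and let $x_1,\dots,x_n\in 2^\omega$ be distinct points of the Cantor space. Then the pointwise stabiliser $(\mathrm{Homeo}\,2^\omega)_{(x_1,\dots,x_n)}=\{g\in\mathrm{Homeo}\,2^\omega: g(x_i)=x_i\ \forall i\in[n]\}$ has ample generics.
   Context: $\mathrm{Homeo}\,2^\omega$ is the group of homeomorphisms of the Cantor space, with its standard Polish topology (the compact-open topology, equivalently the topology of pointwise convergence of its action on the clopen subsets of $2^\omega$); the stabiliser carries the subspace topology. For a topological group $G$ and $m\in\mathbb{N}$, $G$ acts on $G^m$ by diagonal conjugation $(h_1,\dots,h_m)^g=(g^{-1}h_1g,\dots,g^{-1}h_mg)$; a tuple is generic if its orbit is comeagre in $G^m$; $G$ has ample generics if it has generic $m$-tuples for all $m\in\mathbb{N}$. $[n]=\{1,\dots,n\}$. *)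

theory Defs
  imports "HOL-Analysis.Analysis"
begin

definition cantor_top :: "(nat \<Rightarrow> bool) topology" where
  "cantor_top = product_topology (\<lambda>_. discrete_topology (UNIV :: bool set)) (UNIV :: nat set)"

definition clopen_cantor :: "(nat \<Rightarrow> bool) set \<Rightarrow> bool" where
  "clopen_cantor C \<longleftrightarrow> openin cantor_top C \<and> closedin cantor_top C"

definition Homeo :: "((nat \<Rightarrow> bool) \<Rightarrow> (nat \<Rightarrow> bool)) set" where
  "Homeo = {f. homeomorphic_map cantor_top cantor_top f}"

text \<open>Its Polish topology: pointwise convergence of the action on clopen sets, i.e.
  generated by the sets of homeomorphisms mapping a clopen set C onto a clopen set D.\<close>
definition Homeo_top :: "((nat \<Rightarrow> bool) \<Rightarrow> (nat \<Rightarrow> bool)) topology" where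
  "Homeo_top = subtopology
     (topology_generated_by {{g. g ` C = D} | C D. clopen_cantor C \<and> clopen_cantor D}) Homeo"

definition Stab :: "nat \<Rightarrow> (nat \<Rightarrow> (nat \<Rightarrow> bool)) \<Rightarrow> ((nat \<Rightarrow> bool) \<Rightarrow> (nat \<Rightarrow> bool)) set" where
  "Stab n x = {g \<in> Homeo. \<forall>i\<in>{1..n}. g (x i) = x i}"

definition Stab_top :: "nat \<Rightarrow> (nat \<Rightarrow> (nat \<Rightarrow> bool)) \<Rightarrow> ((nat \<Rightarrow> bool) \<Rightarrow> (nat \<Rightarrow> bool)) topology" where
  "Stab_top n x = subtopology Homeo_top (Stab n x)"

definition nowhere_dense_in :: "'a topology \<Rightarrow> 'a set \<Rightarrow> bool" where
  "nowhere_dense_in X S \<longleftrightarrow> S \<subseteq> topspace X \<and> X interior_of (X closure_of S) = {}"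

definition meagre_in :: "'a topology \<Rightarrow> 'a set \<Rightarrow> bool" where
  "meagre_in X S \<longleftrightarrow> S \<subseteq> topspace X \<and>
     (\<exists>N :: nat \<Rightarrow> 'a set. (\<forall>k. nowhere_dense_in X (N k)) \<and> S \<subseteq> (\<Union>k. N k))"

definition comeagre_in :: "'a topology \<Rightarrow> 'a set \<Rightarrow> bool" where
  "comeagre_in X S \<longleftrightarrow> S \<subseteq> topspace X \<and> meagre_in X (topspace X - S)"

text \<open>For a group G of permutations of a type (operation composition, topology T with
  topspace G), m-tuples are elements of G^m indexed by {..<m}, with the product topology;
  G acts by diagonal conjugation.\<close>
definition conj_orbit :: "('b \<Rightarrow> 'b) set \<Rightarrow> nat \<Rightarrow> (nat \<Rightarrow> 'b \<Rightarrow> 'b) \<Rightarrow> (nat \<Rightarrow> 'b \<Rightarrow> 'b) set" where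
  "conj_orbit G m h = {(\<lambda>i\<in>{..<m}. inv g \<circ> h i \<circ> g) | g. g \<in> G}"

definition generic_tuple :: "('b \<Rightarrow> 'b) set \<Rightarrow> ('b \<Rightarrow> 'b) topology \<Rightarrow> nat \<Rightarrow> (nat \<Rightarrow> 'b \<Rightarrow> 'b) \<Rightarrow> bool" where
  "generic_tuple G T m h \<longleftrightarrow>
     h \<in> topspace (product_topology (\<lambda>_. T) {..<m}) \<and>
     comeagre_in (product_topology (\<lambda>_. T) {..<m}) (conj_orbit G m h)"

definition ample_generics :: "('b \<Rightarrow> 'b) set \<Rightarrow> ('b \<Rightarrow> 'b) topology \<Rightarrow> bool" where
  "ample_generics G T \<longleftrightarrow> (\<forall>m::nat. \<exists>h. generic_tuple G T m h)"

end

theory Submission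
  imports Defs
begin

text \<open>
  A tuple of homeomorphisms and a finite clopen partition induce a finite labelled graph on the
  cells: \<open>m\<close> relations, total and surjective, with loops at the cells of the fixed points. Every such
  graph is covered by a \<^emph>\<open>branching\<close> one, in which a vertex has a unique neighbour in all
  directions but possibly one, the direction towards the place from which it was entered. Over a
  branching graph any two finer graphs can be amalgamated: starting anywhere and walking away
  from the exempt direction, the two labellings of the tree of the free group are forced to agree.

  Hence two kinds of conditions are open and dense: every partition has a refinement
  with branching graph, and every partition with branching graph can be refined so as to
  realise any prescribed finer graph. There are countably many of them, and any two tuples
  satisfying them all are conjugate by a back-and-forth construction of matching partitions.
\<close>

section \<open>Locally constant functions and the topology of the homeomorphism group\<close>

text \<open>Graphs are adequate approximations because nonempty clopen sets have no isolated points: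
  a cell can be cut into any number of pieces, so every total, surjective relation on the cells with
  loops at the fixed points is realised exactly by a homeomorphism. The difficulty lies in comparing
  refinements. In the fibre product of two graphs over a common one, neighbours of the two
  components of a vertex need not lie over a common vertex, so totality can fail, and pruning may
  leave nothing. Uniqueness of neighbours in all directions would cure this, but then the relations
  would be permutations of a finite set, and a graph with a vertex on no directed cycle has no such
  cover. One exempt direction per vertex is the compromise: it leaves room for wandering cells,
  while an edge in an exempt direction is still the unique choice when seen from its other end. Over
  a fixed point, a vertex whose only edges are loops serves.\<close>

definition agree :: "nat \<Rightarrow> (nat \<Rightarrow> bool) \<Rightarrow> (nat \<Rightarrow> bool) \<Rightarrow> bool" where
  "agree k y z \<longleftrightarrow> (\<forall>i<k. y i = z i)"

text \<open>A finite clopen partition is encoded by the function naming the cell of each point; a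
  coarser partition is then a composition with a map of labels. The uniform \<open>k\<close> builds
  compactness into the definition.\<close>

definition locally_const :: "((nat \<Rightarrow> bool) \<Rightarrow> 'a) \<Rightarrow> bool" where
  "locally_const \<rho> \<longleftrightarrow> (\<exists>k. \<forall>y z. agree k y z \<longrightarrow> \<rho> y = \<rho> z)"

lemma agree_refl [simp]: "agree k y y"
  by (simp add: agree_def)

lemma agree_sym: "agree k y z \<Longrightarrow> agree k z y"
  by (simp add: agree_def)

lemma agree_trans: "agree k y z \<Longrightarrow> agree k z w \<Longrightarrow> agree k y w"
  by (simp add: agree_def)

lemma agree_mono: "agree k y z \<Longrightarrow> l \<le> k \<Longrightarrow> agree l y z"
  by (simp add: agree_def)

lemma eq_if_agree_all: "(\<And>k. agree k y z) \<Longrightarrow> y = z"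
  unfolding agree_def by blast

lemma locally_constD: "locally_const \<rho> \<Longrightarrow> \<exists>k\<ge>l. \<forall>y z. agree k y z \<longrightarrow> \<rho> y = \<rho> z"
  unfolding locally_const_def by (meson agree_mono max.cobounded1 max.cobounded2)

lemma locally_const_comp: "locally_const \<rho> \<Longrightarrow> locally_const (\<lambda>y. f (\<rho> y))"
  unfolding locally_const_def by metis

lemma locally_const_pair:
  assumes "locally_const \<rho>" "locally_const \<sigma>"
  shows "locally_const (\<lambda>y. (\<rho> y, \<sigma> y))"
proof -
  obtain k where k: "\<forall>y z. agree k y z \<longrightarrow> \<rho> y = \<rho> z"
    using assms(1) by (auto simp: locally_const_def)
  obtain l where "l \<ge> k" "\<forall>y z. agree l y z \<longrightarrow> \<sigma> y = \<sigma> z"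
    using locally_constD[OF assms(2)] by blast
  with k show ?thesis
    unfolding locally_const_def by (metis agree_mono)
qed

section \<open>Open and clopen subsets of the Cantor space\<close>

lemma topspace_cantor [simp]: "topspace cantor_top = UNIV"
  by (simp add: cantor_top_def)

lemma openin_cantor_iff:
  "openin cantor_top S \<longleftrightarrow> (\<forall>y\<in>S. \<exists>k. \<forall>z. agree k y z \<longrightarrow> z \<in> S)"
proof
  assume S: "openin cantor_top S"
  show "\<forall>y\<in>S. \<exists>k. \<forall>z. agree k y z \<longrightarrow> z \<in> S"
  proof
    fix y assume "y \<in> S"
    with S obtain U where U: "finite {i. U i \<noteq> (UNIV::bool set)}" "y \<in> Pi\<^sub>E UNIV U" "Pi\<^sub>E UNIV U \<subseteq> S"
      unfolding cantor_top_def openin_product_topology_alt by force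
    obtain k where k: "\<And>i. U i \<noteq> UNIV \<Longrightarrow> i < k"
      using finite_nat_set_iff_bounded U(1) by auto
    have "z \<in> S" if "agree k y z" for z
    proof -
      have "z i \<in> U i" for i
      proof (cases "i < k")
        case True
        then have "z i = y i" using that by (simp add: agree_def)
        then show ?thesis using U(2) by (auto simp: PiE_iff)
      qed (use k[of i] in auto)
      then show ?thesis using U(3) by (auto simp: PiE_iff)
    qed
    then show "\<exists>k. \<forall>z. agree k y z \<longrightarrow> z \<in> S" by blast
  qed
next
  assume S: "\<forall>y\<in>S. \<exists>k. \<forall>z. agree k y z \<longrightarrow> z \<in> S"
  show "openin cantor_top S"
    unfolding cantor_top_def openin_product_topology_alt
  proof
    fix y assume "y \<in> S"
    with S obtain k where k: "\<And>z. agree k y z \<Longrightarrow> z \<in> S" by blast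
    define U where "U = (\<lambda>i. if i < k then {y i} else UNIV)"
    have "{i. U i \<noteq> UNIV} \<subseteq> {..<k}"
      by (auto simp: U_def)
    then have "finite {i. U i \<noteq> UNIV}"
      using finite_subset by blast
    moreover have "Pi\<^sub>E UNIV U \<subseteq> S"
      by (auto simp: U_def PiE_iff agree_def intro!: k split: if_splits)
    moreover have "y \<in> Pi\<^sub>E UNIV U"
      by (auto simp: U_def)
    ultimately show "\<exists>U. finite {i \<in> UNIV. U i \<noteq> topspace (discrete_topology UNIV)} \<and>
        (\<forall>i\<in>UNIV. openin (discrete_topology UNIV) (U i)) \<and> y \<in> Pi\<^sub>E UNIV U \<and> Pi\<^sub>E UNIV U \<subseteq> S"
      by auto
  qed
qed

lemma compact_cantor: "compact_space cantor_top"
  unfolding cantor_top_def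
  by (simp add: compact_space_product_topology compact_space_discrete_topology)

text \<open>Every point has a cylinder that lies inside \<open>C\<close> or misses it; by
  compactness finitely many cylinders suffice, and a bound on their depths is a uniform
  modulus.\<close>

lemma clopen_iff_locally_const: "clopen_cantor C \<longleftrightarrow> locally_const (\<lambda>y. y \<in> C)"
proof
  assume C: "clopen_cantor C"
  have "\<exists>k. \<forall>z. agree k y z \<longrightarrow> (z \<in> C) = (y \<in> C)" for y
  proof -
    have "openin cantor_top C" "openin cantor_top (- C)"
      using C by (auto simp: clopen_cantor_def closedin_def Compl_eq_Diff_UNIV)
    then show ?thesis
      unfolding openin_cantor_iff by (cases "y \<in> C") auto
  qed
  then obtain k where k: "\<And>y z. agree (k y) y z \<Longrightarrow> (z \<in> C) = (y \<in> C)" by metis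
  define U where "U = (\<lambda>y. {z. agree (k y) y z})"
  have "openin cantor_top (U y)" for y
    unfolding openin_cantor_iff U_def by (auto intro: agree_trans)
  moreover have "topspace cantor_top \<subseteq> \<Union> (range U)"
    by (auto simp: U_def)
  ultimately obtain \<F> where "finite \<F>" "\<F> \<subseteq> range U" "topspace cantor_top \<subseteq> \<Union> \<F>"
    using compact_cantor[unfolded compact_space_alt, rule_format, of "range U"] by auto
  then obtain Y where Y: "finite Y" "UNIV \<subseteq> (\<Union>y\<in>Y. U y)"
    by (metis finite_subset_image topspace_cantor)
  obtain K where K: "\<And>y. y \<in> Y \<Longrightarrow> k y \<le> K"
    using Y(1) by (intro that[of "\<Sum>y\<in>Y. k y"]) (auto intro: member_le_sum)
  have "(z \<in> C) = (w \<in> C)" if "agree K z w" for z w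
  proof -
    obtain y where "y \<in> Y" "agree (k y) y z"
      using Y(2) by (auto simp: U_def)
    moreover have "agree (k y) y w"
      using calculation K that agree_mono agree_trans by blast
    ultimately show ?thesis using k by blast
  qed
  then show "locally_const (\<lambda>y. y \<in> C)"
    unfolding locally_const_def by blast
next
  assume "locally_const (\<lambda>y. y \<in> C)"
  then have "openin cantor_top C" "openin cantor_top (- C)"
    unfolding openin_cantor_iff locally_const_def by auto
  then show "clopen_cantor C"
    by (auto simp: clopen_cantor_def closedin_def Compl_eq_Diff_UNIV)
qed

section \<open>Homeomorphisms in terms of uniform continuity\<close>

lemma Homeo_bij: "g \<in> Homeo \<Longrightarrow> bij g"
  unfolding Homeo_def by (auto simp: homeomorphic_eq_everything_map bij_def)

lemma Homeo_uniform:
  assumes "g \<in> Homeo"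
  shows "\<exists>l. \<forall>y z. agree l y z \<longrightarrow> agree k (g y) (g z)"
proof -
  have "continuous_map cantor_top cantor_top g"
    using assms homeomorphic_imp_continuous_map by (auto simp: Homeo_def)
  have "locally_const (\<lambda>y. g y i)" for i
  proof -
    have op: "openin cantor_top {y. P (y i)}" for P
      unfolding openin_cantor_iff by (auto simp: agree_def intro!: exI[of _ "Suc i"])
    have "openin cantor_top {y. P (g y i)}" for P
      using openin_continuous_map_preimage[OF \<open>continuous_map cantor_top cantor_top g\<close> op] by simp
    from this[of "\<lambda>b. b"] this[of Not] have "clopen_cantor {y. g y i}"
      by (auto simp: clopen_cantor_def closedin_def Compl_eq_Diff_UNIV[symmetric] Collect_neg_eq)
    then show ?thesis
      by (simp add: clopen_iff_locally_const)
  qed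
  then obtain l where l: "\<And>i y z. agree (l i) y z \<Longrightarrow> g y i = g z i"
    unfolding locally_const_def by metis
  have "agree k (g y) (g z)" if "agree (\<Sum>i<k. l i) y z" for y z
    unfolding agree_def
  proof (intro allI impI)
    fix i assume "i < k"
    then have "l i \<le> (\<Sum>i<k. l i)"
      by (auto intro: member_le_sum)
    then show "g y i = g z i"
      using that agree_mono l by blast
  qed
  then show ?thesis by blast
qed

lemma continuous_map_cantorI:
  assumes "\<And>k. \<exists>l. \<forall>y z. agree l y z \<longrightarrow> agree k (g y) (g z)"
  shows "continuous_map cantor_top cantor_top g"
  unfolding continuous_map_alt
proof (intro conjI allI impI)
  fix U assume U: "openin cantor_top U"
  show "openin cantor_top (g -` U \<inter> topspace cantor_top)"
    unfolding openin_cantor_iff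
  proof
    fix y assume "y \<in> g -` U \<inter> topspace cantor_top"
    with U obtain k where "\<And>z. agree k (g y) z \<Longrightarrow> z \<in> U"
      unfolding openin_cantor_iff by blast
    with assms[of k] show "\<exists>k. \<forall>z. agree k y z \<longrightarrow> z \<in> g -` U \<inter> topspace cantor_top"
      by auto
  qed
qed auto

lemma HomeoI:
  assumes "\<And>y. g (f y) = y" "\<And>y. f (g y) = y"
    and "\<And>k. \<exists>l. \<forall>y z. agree l y z \<longrightarrow> agree k (f y) (f z)"
    and "\<And>k. \<exists>l. \<forall>y z. agree l y z \<longrightarrow> agree k (g y) (g z)"
  shows "f \<in> Homeo"
proof -
  have "homeomorphic_maps cantor_top cantor_top f g"
    unfolding homeomorphic_maps_def using assms continuous_map_cantorI by auto
  then show ?thesis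
    unfolding Homeo_def using homeomorphic_map_maps by blast
qed

section \<open>The group topology as uniform convergence\<close>

definition fixing :: "(nat \<Rightarrow> bool) set \<Rightarrow> ((nat \<Rightarrow> bool) \<Rightarrow> (nat \<Rightarrow> bool)) set" where
  "fixing F = {g \<in> Homeo. \<forall>p\<in>F. g p = p}"

abbreviation fixing_top :: "(nat \<Rightarrow> bool) set \<Rightarrow> ((nat \<Rightarrow> bool) \<Rightarrow> (nat \<Rightarrow> bool)) topology" where
  "fixing_top F \<equiv> subtopology Homeo_top (fixing F)"

lemma topspace_Homeo_top: "topspace Homeo_top = Homeo"
proof -
  have "clopen_cantor UNIV"
    by (simp add: clopen_iff_locally_const locally_const_def)
  then have "g \<in> topspace (topology_generated_by {{g. g ` C = D} | C D. clopen_cantor C \<and> clopen_cantor D})"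
    if "g \<in> Homeo" for g
    using Homeo_bij[OF that] by (auto simp: topology_generated_by_topspace bij_def)
  then show ?thesis
    unfolding Homeo_top_def by auto
qed

lemma topspace_fixing_top [simp]: "topspace (fixing_top F) = fixing F"
  by (auto simp: topspace_Homeo_top fixing_def)

text \<open>For bijective \<open>g\<close>, the subbasic condition that \<open>g\<close> map
  \<open>{y. g0 y i}\<close> onto \<open>{z. z i}\<close> says exactly that \<open>g\<close> and
  \<open>g0\<close> have the same \<open>i\<close>-th output bit everywhere; \<open>k\<close> such
  conditions cut out the set.\<close>

lemma openin_fixing_nbhd:
  assumes "g0 \<in> fixing F"
  shows "openin (fixing_top F) {g \<in> fixing F. \<forall>y. agree k (g y) (g0 y)}"
proof -
  let ?T = "topology_generated_by {{g. g ` C = D} | C D. clopen_cantor C \<and> clopen_cantor D}"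
  let ?N = "\<lambda>i. {g. g ` {y. g0 y i} = {z. z i}}"
  have bij: "bij g" if "g \<in> fixing F" for g
    using that Homeo_bij by (auto simp: fixing_def)
  have "openin ?T (?N i)" for i
  proof (rule topology_generated_by_Basis)
    have 1: "clopen_cantor {z. z i}"
      unfolding clopen_iff_locally_const locally_const_def agree_def by auto
    obtain l where "\<forall>y z. agree l y z \<longrightarrow> agree (Suc i) (g0 y) (g0 z)"
      using Homeo_uniform assms by (fastforce simp: fixing_def)
    then have "agree l y z \<longrightarrow> g0 y i = g0 z i" for y z
      by (auto simp: agree_def)
    then have 2: "clopen_cantor {y. g0 y i}"
      unfolding clopen_iff_locally_const locally_const_def by auto
    from 1 2 show "?N i \<in> {{g. g ` C = D} | C D. clopen_cantor C \<and> clopen_cantor D}"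
      by blast
  qed
  then have N: "openin (fixing_top F) (?N i \<inter> fixing F)" for i
    unfolding Homeo_top_def openin_subtopology by (auto simp: fixing_def)
  \<comment> \<open>For \<open>k = 0\<close> the family is empty and its intersection is everything,
    hence the explicit \<open>fixing F\<close>.\<close>
  have eq: "fixing F \<inter> \<Inter> ((\<lambda>i. ?N i \<inter> fixing F) ` {..<k}) =
      {g \<in> fixing F. \<forall>y. agree k (g y) (g0 y)}"
  proof -
    have iff: "g ` {y. g0 y i} = {z. z i} \<longleftrightarrow> (\<forall>y. g y i = g0 y i)" if "g \<in> fixing F" for g i
    proof
      assume *: "g ` {y. g0 y i} = {z. z i}"
      show "\<forall>y. g y i = g0 y i"
      proof
        fix y
        have "g y i \<longleftrightarrow> g y \<in> g ` {y. g0 y i}" using * by simp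
        also have "\<dots> \<longleftrightarrow> g0 y i" using bij[OF that] by (auto simp: bij_def inj_def)
        finally show "g y i = g0 y i" .
      qed
    next
      assume "\<forall>y. g y i = g0 y i"
      then have "{y. g0 y i} = g -` {z. z i}" by auto
      then show "g ` {y. g0 y i} = {z. z i}"
        using bij_is_surj[OF bij[OF that]] by (metis surj_image_vimage_eq)
    qed
    have "g \<in> ?N i \<inter> fixing F \<longleftrightarrow> g \<in> {g \<in> fixing F. \<forall>y. g y i = g0 y i}" for g i
      by (cases "g \<in> fixing F") (simp_all only: Int_iff mem_Collect_eq iff simp_thms)
    then have "?N i \<inter> fixing F = {g \<in> fixing F. \<forall>y. g y i = g0 y i}" for i
      by (rule set_eqI)
    then show ?thesis
      by (auto simp: agree_def)
  qed
  have "openin (fixing_top F) (fixing F)"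
    by (metis openin_topspace topspace_fixing_top)
  then show ?thesis
    unfolding eq[symmetric] by (intro openin_Int_Inter) (use N in auto)
qed

text \<open>For a subbasic set given by \<open>C\<close> and \<open>D\<close>, membership in
  \<open>D\<close> is decided by \<open>k\<close> bits, so a bijection agreeing with
  \<open>g\<close> in these bits also sends \<open>C\<close> into \<open>D\<close> and the
  complement into the complement.\<close>

lemma openin_fixing_imp_nbhd:
  assumes "openin (fixing_top F) W" "g \<in> W"
  shows "\<exists>k. \<forall>g'\<in>fixing F. (\<forall>y. agree k (g' y) (g y)) \<longrightarrow> g' \<in> W"
proof -
  let ?S = "{{g. g ` C = D} | C D. clopen_cantor C \<and> clopen_cantor D}"
  have Wsub: "W \<subseteq> fixing F"
    using openin_subset[OF assms(1)] by simp
  obtain U where U: "openin (topology_generated_by ?S) U" "W = U \<inter> Homeo \<inter> fixing F"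
    using assms(1) unfolding Homeo_top_def openin_subtopology by auto
  have "generate_topology_on ?S U"
    using U(1) by (simp add: openin_topology_generated_by_iff)
  then have "g \<in> U \<longrightarrow> (\<exists>k. \<forall>g'\<in>fixing F. (\<forall>y. agree k (g' y) (g y)) \<longrightarrow> g' \<in> U)"
  proof induction
    case (Int a b)
    show ?case
    proof
      assume "g \<in> a \<inter> b"
      with Int obtain k l where "\<forall>g'\<in>fixing F. (\<forall>y. agree k (g' y) (g y)) \<longrightarrow> g' \<in> a"
        "\<forall>g'\<in>fixing F. (\<forall>y. agree l (g' y) (g y)) \<longrightarrow> g' \<in> b" by blast
      then show "\<exists>k. \<forall>g'\<in>fixing F. (\<forall>y. agree k (g' y) (g y)) \<longrightarrow> g' \<in> a \<inter> b"
        by (intro exI[of _ "max k l"]) (meson IntI agree_mono max.cobounded1 max.cobounded2)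
    qed
  next
    case (UN K)
    then show ?case by (meson UnionE UnionI)
  next
    case (Basis s)
    then obtain C D where s: "s = {g. g ` C = D}" and D: "clopen_cantor D" by blast
    then obtain k where k: "\<forall>y z. agree k y z \<longrightarrow> (y \<in> D) = (z \<in> D)"
      by (auto simp: clopen_iff_locally_const locally_const_def)
    have "g' ` C = D" if "g \<in> s" "g' \<in> fixing F" "\<forall>y. agree k (g' y) (g y)" for g'
    proof -
      have "bij g" "bij g'"
        using assms(2) Wsub that(2) Homeo_bij by (auto simp: fixing_def)
      have "y \<in> C \<longleftrightarrow> g' y \<in> D" for y
      proof -
        have "y \<in> C \<longleftrightarrow> g y \<in> D"
          using that(1) s \<open>bij g\<close> by (auto simp: bij_def inj_def)
        then show ?thesis using k that(3) by blast
      qed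
      then show ?thesis
        using bij_is_surj[OF \<open>bij g'\<close>] by (auto simp: image_iff) (metis surjD)
    qed
    then show ?case using s by blast
  qed auto
  then show ?thesis
    using U assms(2) by (auto simp: fixing_def)
qed

section \<open>Lifting partitions and back-and-forth\<close>

text \<open>Flipping a single bit beyond the modulus \<open>k\<close> stays in the cell, and
  different positions give different points.\<close>

lemma infinite_fibre:
  assumes "locally_const \<rho>"
  shows "infinite {w. \<rho> w = \<rho> y}"
proof -
  obtain k where k: "\<forall>y z. agree k y z \<longrightarrow> \<rho> y = \<rho> z"
    using assms by (auto simp: locally_const_def)
  define w where "w = (\<lambda>i. y(k + i := \<not> y (k + i)))"
  have "inj w"
    by (auto simp: inj_def w_def fun_eq_iff)
  moreover have "range w \<subseteq> {w. \<rho> w = \<rho> y}"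
  proof -
    have "agree k (w i) y" for i by (auto simp: agree_def w_def)
    then show ?thesis using k by auto
  qed
  ultimately show ?thesis
    using finite_imageD infinite_super by blast
qed

lemma inj_section_avoiding:
  assumes "locally_const \<rho>" "finite F" "finite V" "\<delta> ` V \<subseteq> range \<rho>"
  shows "\<exists>y. inj_on y V \<and> (\<forall>v\<in>V. \<rho> (y v) = \<delta> v \<and> y v \<notin> F)"
  using assms(3,4)
proof (induction V)
  case (insert a V)
  then obtain y where y: "inj_on y V" "\<forall>v\<in>V. \<rho> (y v) = \<delta> v \<and> y v \<notin> F" by auto
  obtain z0 where "\<rho> z0 = \<delta> a" using insert by auto
  then have "infinite ({w. \<rho> w = \<delta> a} - (F \<union> y ` V))"
    using infinite_fibre[OF assms(1), of z0] insert(1) assms(2) by auto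
  then obtain z where "\<rho> z = \<delta> a" "z \<notin> F" "z \<notin> y ` V"
    using infinite_imp_nonempty by blast
  with y insert(2) show ?case
    by (intro exI[of _ "y(a := z)"]) (auto simp: inj_on_def image_iff)
qed auto

lemma finite_separated:
  assumes "finite F"
  shows "\<exists>k\<ge>l. \<forall>y\<in>F. \<forall>z\<in>F. agree k y z \<longrightarrow> y = z"
proof -
  have "\<forall>y z :: nat \<Rightarrow> bool. \<exists>i. y \<noteq> z \<longrightarrow> y i \<noteq> z i"
    by (auto simp: fun_eq_iff)
  then obtain d where d: "\<And>y z :: nat \<Rightarrow> bool. y \<noteq> z \<longrightarrow> y (d y z) \<noteq> z (d y z)"
    by metis
  \<comment> \<open>\<open>Suc\<close> because \<open>agree k\<close> sees only the coordinates
    strictly below \<open>k\<close>.\<close>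
  define k where "k = l + (\<Sum>(y, z)\<in>F \<times> F. Suc (d y z))"
  have "y = z" if "y \<in> F" "z \<in> F" "agree k y z" for y z
  proof -
    have "(\<lambda>(y, z). Suc (d y z)) (y, z) \<le> (\<Sum>(y, z)\<in>F \<times> F. Suc (d y z))"
      using that assms by (intro member_le_sum) auto
    then have "d y z < k" by (simp add: k_def)
    then show ?thesis using d that(3) unfolding agree_def by blast
  qed
  moreover have "k \<ge> l" by (simp add: k_def)
  ultimately show ?thesis by blast
qed

text \<open>Cells can be subdivided at will, with prescribed pieces at the points of
  \<open>F\<close>. Each new label gets a witness point; points of \<open>F\<close> and witnesses
  are separated at some depth \<open>k\<close>. A cylinder of depth \<open>k\<close> through one of
  them takes its label, all others take a default label over their cell. The witnesses ensure that
  every label occurs.\<close>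

lemma locally_const_lift:
  fixes \<delta> :: "'v \<Rightarrow> 'a" and d :: "(nat \<Rightarrow> bool) \<Rightarrow> 'v"
  assumes \<rho>: "locally_const \<rho>" and F: "finite F" and V: "finite V" "\<delta> ` V = range \<rho>"
    and d: "\<And>p. p \<in> F \<Longrightarrow> d p \<in> V \<and> \<delta> (d p) = \<rho> p"
  obtains \<sigma> where "locally_const \<sigma>" "range \<sigma> = V" "\<And>y. \<delta> (\<sigma> y) = \<rho> y" "\<And>p. p \<in> F \<Longrightarrow> \<sigma> p = d p"
proof -
  obtain y where y: "inj_on y V" "\<forall>v\<in>V. \<rho> (y v) = \<delta> v \<and> y v \<notin> F"
    using inj_section_avoiding[OF \<rho> F V(1)] V(2) by blast
  define H where "H = F \<union> y ` V"
  define lab where "lab = (\<lambda>z. if z \<in> F then d z else the_inv_into V y z)"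
  have lab: "lab z \<in> V \<and> \<delta> (lab z) = \<rho> z" if "z \<in> H" for z
    using that d y by (auto simp: H_def lab_def the_inv_into_f_f)
  have lab_y: "lab (y v) = v" if "v \<in> V" for v
    using that y by (auto simp: lab_def the_inv_into_f_f)
  obtain l where l: "\<forall>y z. agree l y z \<longrightarrow> \<rho> y = \<rho> z"
    using \<rho> by (auto simp: locally_const_def)
  have "finite H" using F V by (simp add: H_def)
  then obtain k where k: "k \<ge> l" "\<forall>y\<in>H. \<forall>z\<in>H. agree k y z \<longrightarrow> y = z"
    using finite_separated by blast
  define dflt where "dflt = (\<lambda>a. SOME v. v \<in> V \<and> \<delta> v = a)"
  have dflt: "dflt (\<rho> w) \<in> V \<and> \<delta> (dflt (\<rho> w)) = \<rho> w" for w
    unfolding dflt_def by (rule someI_ex) (use V(2) in \<open>metis imageE rangeI\<close>)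
  define cl where "cl = (\<lambda>w. SOME z. z \<in> H \<and> agree k w z)"
  have cl: "cl w \<in> H \<and> agree k w (cl w)" if "\<exists>z\<in>H. agree k w z" for w
    using someI_ex[of "\<lambda>z. z \<in> H \<and> agree k w z"] that unfolding cl_def by blast
  define \<sigma> where "\<sigma> = (\<lambda>w. if \<exists>z\<in>H. agree k w z then lab (cl w) else dflt (\<rho> w))"
  have \<sigma>_H: "\<sigma> z = lab z" if "z \<in> H" for z
  proof -
    have "\<exists>w\<in>H. agree k z w" using that agree_refl by blast
    moreover from this have "cl z = z" using cl k(2) that by metis
    ultimately show ?thesis by (simp add: \<sigma>_def)
  qed
  have \<sigma>: "\<sigma> w \<in> V \<and> \<delta> (\<sigma> w) = \<rho> w" for w
  proof (cases "\<exists>z\<in>H. agree k w z")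
    case True
    then have "\<rho> (cl w) = \<rho> w" using cl k(1) l agree_mono by metis
    then show ?thesis using True lab cl by (simp add: \<sigma>_def)
  next
    case False
    then show ?thesis using dflt unfolding \<sigma>_def by auto
  qed
  have "\<sigma> w = \<sigma> w'" if "agree k w w'" for w w'
  proof -
    have *: "agree k w z \<longleftrightarrow> agree k w' z" for z
      using that agree_sym agree_trans by blast
    moreover have "\<rho> w = \<rho> w'" using that k(1) l agree_mono by blast
    ultimately show ?thesis by (simp add: \<sigma>_def cl_def)
  qed
  then have "locally_const \<sigma>" unfolding locally_const_def by blast
  moreover have "range \<sigma> = V"
  proof
    show "V \<subseteq> range \<sigma>"
    proof
      fix v assume "v \<in> V"
      then have "\<sigma> (y v) = v" using \<sigma>_H lab_y by (simp add: H_def)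
      then show "v \<in> range \<sigma>" by (metis rangeI)
    qed
  qed (use \<sigma> in auto)
  moreover have "\<sigma> p = d p" if "p \<in> F" for p
    using that \<sigma>_H by (simp add: H_def lab_def)
  ultimately show ?thesis using that \<sigma> by blast
qed

section \<open>Homeomorphisms as limits of matching partitions\<close>

definition determines :: "((nat \<Rightarrow> bool) \<Rightarrow> 'a) \<Rightarrow> nat \<Rightarrow> bool" where
  "determines u k \<longleftrightarrow> (\<forall>y z. u y = u z \<longrightarrow> agree k y z)"

text \<open>The image of \<open>y\<close> is the common point of the nested cells of
  \<open>W k\<close> with label \<open>U k y\<close>. The shared maps \<open>\<phi>\<close> make
  these cells decrease, and \<open>determines\<close> makes them shrink to a point.\<close>

lemma limit_map:
  fixes U W :: "nat \<Rightarrow> (nat \<Rightarrow> bool) \<Rightarrow> 'a"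
  assumes W: "\<And>k. locally_const (W k)" "\<And>k. determines (W k) k"
    and range: "\<And>k. range (U k) \<subseteq> range (W k)"
    and \<phi>: "\<And>k y. \<phi> k (U (Suc k) y) = U k y" "\<And>k y. \<phi> k (W (Suc k) y) = W k y"
  obtains g where "\<And>k y. W k (g y) = U k y"
proof -
  have mono: "W k z = U k y" if "W l z = U l y" "k \<le> l" for k l y z
    using that(2,1) by (induction rule: dec_induct) (metis \<phi>)+
  have "\<exists>z. W k z = U k y" for k y
    using range[of k] by (metis imageE rangeI subsetD)
  then obtain z where z: "\<And>k y. W k (z k y) = U k y" by metis
  \<comment> \<open>Stage \<open>Suc i\<close> is the first one guaranteed to decide bit
    \<open>i\<close>.\<close>
  define g where "g = (\<lambda>y i. z (Suc i) y i)"
  have "agree k (g y) (z k y)" for k y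
    unfolding agree_def
  proof (intro allI impI)
    fix i assume "i < k"
    then have "W (Suc i) (z k y) = W (Suc i) (z (Suc i) y)"
      using mono[OF z, of "Suc i" k y] z by simp
    then show "g y i = z k y i"
      using W(2)[of "Suc i"] by (simp add: determines_def agree_def g_def)
  qed
  then have "W k (g y) = U k y" for k y
  proof -
    \<comment> \<open>The modulus of \<open>W k\<close> may exceed \<open>k\<close>, so the
      agreement is used at a later stage \<open>l\<close> and carried back to \<open>k\<close> by
      \<open>mono\<close>.\<close>
    obtain l where "k \<le> l" "\<forall>y z. agree l y z \<longrightarrow> W k y = W k z"
      using locally_constD[OF W(1)] by blast
    then show ?thesis using \<open>\<And>k y. agree k (g y) (z k y)\<close> mono[OF z] by metis
  qed
  then show ?thesis using that by blast
qed

lemma eq_if_determines_all: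
  assumes "\<And>k. determines (W k) k" "\<And>k. W k y = W k z"
  shows "y = z"
  using assms eq_if_agree_all unfolding determines_def by blast

lemma limit_map_uniform:
  assumes "\<And>k. determines (W k) k" "\<And>k. locally_const (U k)" "\<And>k y. W k (g y) = U k y"
  shows "\<exists>l. \<forall>y z. agree l y z \<longrightarrow> agree k (g y) (g z)"
proof -
  obtain l where "\<forall>y z. agree l y z \<longrightarrow> U k y = U k z"
    using assms(2)[of k] by (auto simp: locally_const_def)
  then show ?thesis using assms(1,3) unfolding determines_def by metis
qed

text \<open>Both sides are refined with the same label map \<open>\<phi>\<close>, so each sequence
  of partitions serves as target for the other. The two limit maps are mutually inverse because
  cells determine points.\<close>

lemma back_and_forth:
  fixes P :: "((nat \<Rightarrow> bool) \<Rightarrow> 'a) \<Rightarrow> ((nat \<Rightarrow> bool) \<Rightarrow> 'a) \<Rightarrow> bool"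
  assumes start: "P u0 v0"
    and P: "\<And>u v. P u v \<Longrightarrow> locally_const u \<and> locally_const v \<and> range u = range v \<and> (\<forall>p\<in>F. u p = v p)"
    and step: "\<And>u v k. P u v \<Longrightarrow> \<exists>u' v' \<phi>. P u' v' \<and> (\<forall>y. \<phi> (u' y) = u y) \<and> (\<forall>y. \<phi> (v' y) = v y) \<and>
      determines u' k \<and> determines v' k"
  obtains g where "g \<in> fixing F" "\<forall>y. v0 (g y) = u0 y"
    "\<forall>k. \<exists>u v. P u v \<and> determines u k \<and> (\<forall>y. v (g y) = u y)"
proof -
  obtain u1 v1 \<phi>1 where 1: "P u1 v1" "\<And>y. \<phi>1 (u1 y) = u0 y" "\<And>y. \<phi>1 (v1 y) = v0 y"
    "determines u1 0" "determines v1 0"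
    using step[OF start] by metis
  define R where "R = (\<lambda>(k::nat) (s :: ((nat \<Rightarrow> bool) \<Rightarrow> 'a) \<times> ((nat \<Rightarrow> bool) \<Rightarrow> 'a)) s'.
    \<exists>\<phi> :: 'a \<Rightarrow> 'a. (\<forall>y. \<phi> (fst s' y) = fst s y) \<and> (\<forall>y. \<phi> (snd s' y) = snd s y))"
  define Q where "Q = (\<lambda>k s. P (fst s) (snd s) \<and> determines (fst s) k \<and> determines (snd s) k)"
  \<comment> \<open>The clause for \<open>k = 0\<close> pins the first pair, through which the limit
    is tied to \<open>u0\<close> and \<open>v0\<close>.\<close>
  have "\<exists>S. \<forall>k. (Q k (S k) \<and> (k = 0 \<longrightarrow> S k = (u1, v1))) \<and> R k (S k) (S (Suc k))"
  proof (rule dependent_nat_choice)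
    show "\<exists>s. Q 0 s \<and> (0 = (0::nat) \<longrightarrow> s = (u1, v1))"
      using 1 by (auto simp: Q_def)
  next
    fix s k assume "Q k s \<and> (k = 0 \<longrightarrow> s = (u1, v1))"
    then have "P (fst s) (snd s)" by (simp add: Q_def)
    from step[OF this, of "Suc k"]
    show "\<exists>s'. (Q (Suc k) s' \<and> (Suc k = 0 \<longrightarrow> s' = (u1, v1))) \<and> R k s s'"
      unfolding Q_def R_def by auto
  qed
  then obtain S where Q: "\<And>k. Q k (S k)" and R: "\<And>k. R k (S k) (S (Suc k))" and S0: "S 0 = (u1, v1)"
    by blast
  define U where "U = (\<lambda>k. fst (S k))"
  define W where "W = (\<lambda>k. snd (S k))"
  from R obtain \<phi> where \<phi>: "\<And>k y. \<phi> k (U (Suc k) y) = U k y" "\<And>k y. \<phi> k (W (Suc k) y) = W k y"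
    unfolding R_def U_def W_def by metis
  have PUW: "P (U k) (W k)" and det: "determines (U k) k" "determines (W k) k" for k
    using Q by (auto simp: Q_def U_def W_def)
  have lc: "locally_const (U k)" "locally_const (W k)" and rg: "range (U k) = range (W k)"
    and mark: "\<And>p. p \<in> F \<Longrightarrow> U k p = W k p" for k
    using P[OF PUW] by auto
  obtain g where g: "\<And>k y. W k (g y) = U k y"
    using limit_map[of W U \<phi>] lc det rg \<phi> by auto
  obtain f where f: "\<And>k y. U k (f y) = W k y"
    using limit_map[of U W \<phi>] lc det rg \<phi> by auto
  have "g \<in> Homeo"
  proof (rule HomeoI)
    show "f (g y) = y" for y
      by (rule eq_if_determines_all[of U]) (simp_all add: det f g)
    show "g (f y) = y" for y
      by (rule eq_if_determines_all[of W]) (simp_all add: det f g)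
    show "\<exists>l. \<forall>y z. agree l y z \<longrightarrow> agree k (g y) (g z)" for k
      by (rule limit_map_uniform[of W U]) (simp_all add: det lc g)
    show "\<exists>l. \<forall>y z. agree l y z \<longrightarrow> agree k (f y) (f z)" for k
      by (rule limit_map_uniform[of U W]) (simp_all add: det lc f)
  qed
  moreover have "g p = p" if "p \<in> F" for p
    by (rule eq_if_determines_all[of W]) (simp_all add: det g mark that)
  ultimately have "g \<in> fixing F" by (simp add: fixing_def)
  moreover have "v0 (g y) = u0 y" for y
    using g[of 0 y] 1(2,3) S0 by (metis U_def W_def fst_conv snd_conv)
  moreover have "\<exists>u v. P u v \<and> determines u k \<and> (\<forall>y. v (g y) = u y)" for k
    using PUW det g by blast
  ultimately show ?thesis using that by blast
qed

section \<open>The partition into cylinders, and homogeneity of the stabiliser\<close>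

definition prefix_of :: "nat \<Rightarrow> (nat \<Rightarrow> bool) \<Rightarrow> bool list" where
  "prefix_of k y = map y [0..<k]"

lemma prefix_of_eq_iff: "prefix_of k y = prefix_of k z \<longleftrightarrow> agree k y z"
  by (auto simp: prefix_of_def agree_def)

lemma locally_const_prefix_of: "locally_const (prefix_of k)"
  unfolding locally_const_def using prefix_of_eq_iff by blast

lemma locally_const_factor:
  assumes "locally_const \<rho>"
  obtains k f where "k \<ge> l" "\<And>y. \<rho> y = f (prefix_of k y)"
proof -
  obtain k where "k \<ge> l" and k: "\<forall>y z. agree k y z \<longrightarrow> \<rho> y = \<rho> z"
    using locally_constD[OF assms] by blast
  moreover have "\<rho> y = \<rho> (inv (prefix_of k) (prefix_of k y))" for y
    using k by (metis f_inv_into_f prefix_of_eq_iff rangeI)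
  ultimately show ?thesis
    using that[of k "\<lambda>w. \<rho> (inv (prefix_of k) w)"] by blast
qed

lemma finite_range_prefix_of: "finite (range (prefix_of k))"
proof (rule finite_subset)
  show "range (prefix_of k) \<subseteq> {xs. set xs \<subseteq> UNIV \<and> length xs = k}"
    by (auto simp: prefix_of_def)
qed (rule finite_lists_length_eq, simp)

lemma finite_range_locally_const:
  assumes "locally_const \<rho>" shows "finite (range \<rho>)"
proof -
  obtain k f where "\<And>y. \<rho> y = f (prefix_of k y)"
    using locally_const_factor[OF assms] by metis
  then have "range \<rho> = f ` range (prefix_of k)" by auto
  then show ?thesis using finite_range_prefix_of by simp
qed

lemma determines_mono: "determines u k \<Longrightarrow> (\<And>y. \<phi> (u' y) = u y) \<Longrightarrow> determines u' k"
  unfolding determines_def by metis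

text \<open>Back and forth without dynamics: one side is refined by prefixes, the other is lifted to
  the new label set. The labels carry a stack of the prefixes used so far; this keeps all
  refinements in one type, and \<open>tl\<close> undoes the last one.\<close>

lemma fixing_homogeneous:
  fixes u v :: "(nat \<Rightarrow> bool) \<Rightarrow> 'a"
  assumes F: "finite F" and u: "locally_const u" and v: "locally_const v" and "range u = range v"
    and marks: "\<And>p. p \<in> F \<Longrightarrow> u p = v p"
  obtains g where "g \<in> fixing F" "\<And>y. v (g y) = u y"
proof -
  define P where "P = (\<lambda>(a :: (nat \<Rightarrow> bool) \<Rightarrow> 'a \<times> bool list list) b.
    locally_const a \<and> locally_const b \<and> range a = range b \<and> (\<forall>p\<in>F. a p = b p))"
  have P_sym: "P b a" if "P a b" for a b
    using that by (auto simp: P_def)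
  define \<phi> where "\<phi> = (\<lambda>(c :: 'a, ws :: bool list list). (c, tl ws))"
  have forth: "\<exists>a' b'. P a' b' \<and> (\<forall>y. \<phi> (a' y) = a y) \<and> (\<forall>y. \<phi> (b' y) = b y) \<and> determines a' k"
    if "P a b" for a b k
  proof -
    define a' where "a' = (\<lambda>y. (fst (a y), prefix_of k y # snd (a y)))"
    have a: "locally_const a" "locally_const b" "range a = range b" "\<And>p. p \<in> F \<Longrightarrow> a p = b p"
      using that by (auto simp: P_def)
    have "locally_const a'"
      unfolding a'_def using a(1) locally_const_prefix_of[of k]
      by (intro locally_const_pair locally_const_comp[of a fst]
          locally_const_comp[of "\<lambda>y. (prefix_of k y, snd (a y))" "\<lambda>(x, y). x # y", simplified]
          locally_const_comp[of a snd])
    have \<phi>a': "\<phi> (a' y) = a y" for y by (simp add: a'_def \<phi>_def)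
    have "\<phi> ` range a' = range b"
      using a(3) \<phi>a' by (auto simp: image_image)
    moreover have "a' p \<in> range a' \<and> \<phi> (a' p) = b p" if "p \<in> F" for p
      using a(4)[OF that] \<phi>a' by simp
    ultimately obtain b' where
      "locally_const b'" "range b' = range a'" "\<And>y. \<phi> (b' y) = b y" "\<And>p. p \<in> F \<Longrightarrow> b' p = a' p"
      using locally_const_lift[of b F "range a'" \<phi> a', OF a(2) F
          finite_range_locally_const[OF \<open>locally_const a'\<close>]] by metis
    moreover have "determines a' k"
      by (auto simp: determines_def a'_def prefix_of_eq_iff)
    ultimately show ?thesis
      using \<open>locally_const a'\<close> \<phi>a' by (intro exI[of _ a'] exI[of _ b']) (auto simp: P_def)
  qed
  have step: "\<exists>a' b' \<phi>. P a' b' \<and> (\<forall>y. \<phi> (a' y) = a y) \<and> (\<forall>y. \<phi> (b' y) = b y) \<and>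
      determines a' k \<and> determines b' k" if Pab: "P a b" for a b k
  proof -
    obtain a1 b1 where 1: "P a1 b1" "\<And>y. \<phi> (a1 y) = a y" "\<And>y. \<phi> (b1 y) = b y" "determines a1 k"
      using forth[OF Pab] by metis
    obtain a2 b2 where 2: "P b2 a2" "\<And>y. \<phi> (a2 y) = a1 y" "\<And>y. \<phi> (b2 y) = b1 y" "determines b2 k"
      using forth[OF P_sym[OF 1(1)]] by metis
    have "determines a2 k" using determines_mono[OF 1(4), of \<phi> a2] 2(2) by blast
    with 1 2 P_sym[OF 2(1)] show ?thesis
      by (intro exI[of _ a2] exI[of _ b2] exI[of _ "\<lambda>x. \<phi> (\<phi> x)"]) auto
  qed
  have "range (\<lambda>y. (w y, [] :: bool list list)) = (\<lambda>c. (c, [])) ` range w" for w :: "(nat \<Rightarrow> bool) \<Rightarrow> 'a"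
    by auto
  then have start: "P (\<lambda>y. (u y, [])) (\<lambda>y. (v y, []))"
    using assms(4) marks locally_const_comp[OF u, of "\<lambda>c. (c, [])"] locally_const_comp[OF v, of "\<lambda>c. (c, [])"]
    by (simp add: P_def)
  have PD: "locally_const a \<and> locally_const b \<and> range a = range b \<and> (\<forall>p\<in>F. a p = b p)"
    if "P a b" for a b
    using that by (simp add: P_def)
  show ?thesis
  proof (rule back_and_forth[OF start PD step])
    fix g assume "g \<in> fixing F" "\<forall>y. (v (g y), [] :: bool list list) = (u y, [])"
    then show thesis using that by simp
  qed
qed

section \<open>Graphs of partitions\<close>

text \<open>A tuple of \<open>m\<close> homeomorphisms induces on the set of cells of a finite partition the
  \<open>m\<close> relations ``some point of \<open>a\<close> is mapped into \<open>b\<close>''. Directions \<open>(i, True)\<close> and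
  \<open>(i, False)\<close> stand for following the \<open>i\<close>-th relation forwards and backwards.\<close>
type_synonym 'v edges = "(nat \<times> 'v \<times> 'v) set"

definition dirs :: "nat \<Rightarrow> (nat \<times> bool) set" where
  "dirs m = {..<m} \<times> UNIV"

definition opp :: "nat \<times> bool \<Rightarrow> nat \<times> bool" where
  "opp s = (fst s, \<not> snd s)"

definition adj :: "'v edges \<Rightarrow> nat \<times> bool \<Rightarrow> 'v \<Rightarrow> 'v \<Rightarrow> bool" where
  "adj E s a b \<longleftrightarrow> (if snd s then (fst s, a, b) \<in> E else (fst s, b, a) \<in> E)"

lemma opp_opp [simp]: "opp (opp s) = s"
  by (simp add: opp_def)

lemma opp_in_dirs [simp]: "opp s \<in> dirs m \<longleftrightarrow> s \<in> dirs m"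
  by (cases s) (simp add: opp_def dirs_def)

lemma adj_opp [simp]: "adj E (opp s) a b \<longleftrightarrow> adj E s b a"
  by (auto simp: adj_def opp_def)

text \<open>Totality in the directions \<open>(i, False)\<close> is the surjectivity of the
  relations.\<close>

definition total_graph :: "nat \<Rightarrow> 'v set \<Rightarrow> 'v edges \<Rightarrow> bool" where
  "total_graph m V E \<longleftrightarrow> finite V \<and> E \<subseteq> {..<m} \<times> V \<times> V \<and> (\<forall>a\<in>V. \<forall>s\<in>dirs m. \<exists>b. adj E s a b)"

lemma total_graph_adjD:
  assumes "total_graph m V E" "adj E s a b"
  shows "a \<in> V" "b \<in> V" "s \<in> dirs m"
  using assms unfolding total_graph_def adj_def dirs_def by (cases s; auto split: if_splits)+

lemma total_graph_adjE:
  assumes "total_graph m V E" "a \<in> V" "s \<in> dirs m"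
  obtains b where "adj E s a b" "b \<in> V"
  using assms total_graph_adjD unfolding total_graph_def by metis

definition edge_map :: "('v \<Rightarrow> 'w) \<Rightarrow> 'v edges \<Rightarrow> 'w edges" where
  "edge_map f E = (\<lambda>(i, a, b). (i, f a, f b)) ` E"

lemma adj_edge_map: "adj E s a b \<Longrightarrow> adj (edge_map f E) s (f a) (f b)"
  by (force simp: adj_def edge_map_def split: if_splits)

lemma adj_mono: "E \<subseteq> E' \<Longrightarrow> adj E s a b \<Longrightarrow> adj E' s a b"
  by (auto simp: adj_def split: if_splits)

text \<open>\<open>T a\<close> is a set of directions in which the neighbour of \<open>a\<close> is unique. At most one direction
  is exempt, namely the one leading back to where \<open>a\<close> was entered from; so a labelling of
  the tree of the free group by \<open>E\<close> is determined away from any vertex by the label there.\<close>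
locale branch_system =
  fixes m :: nat and M :: "'v set" and E :: "'v edges" and T :: "'v \<Rightarrow> (nat \<times> bool) set"
  assumes uniq: "s \<in> T a \<Longrightarrow> adj E s a b \<Longrightarrow> adj E s a b' \<Longrightarrow> b = b'"
    and child: "s \<in> T a \<Longrightarrow> adj E s a b \<Longrightarrow> dirs m - {opp s} \<subseteq> T b"
    and orient: "adj E s a b \<Longrightarrow> s \<in> T a \<or> opp s \<in> T b"
    and single: "adj E s a b \<Longrightarrow> s \<notin> T a \<Longrightarrow> t \<in> dirs m - T a \<Longrightarrow> t = s"
    and marked: "a \<in> M \<Longrightarrow> dirs m \<subseteq> T a"

definition branching :: "nat \<Rightarrow> 'v set \<Rightarrow> 'v edges \<Rightarrow> bool" where
  "branching m M E \<longleftrightarrow> (\<exists>T. branch_system m M E T)"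

text \<open>Used to rename cells: first from trees of labels to numbers, later when a label is
  paired with that of a coarser cell. Injectivity reflects uniqueness of neighbours.\<close>

lemma branching_inj_pullback:
  assumes "branching m (f ` M) (edge_map f E)" "inj_on f V" "E \<subseteq> {..<m} \<times> V \<times> V"
  shows "branching m M E"
proof -
  obtain T where T: "branch_system m (f ` M) (edge_map f E) T"
    using assms(1) by (auto simp: branching_def)
  have V: "a \<in> V \<and> b \<in> V" if "adj E s a b" for s a b
    using assms(3) that by (auto simp: adj_def split: if_splits)
  interpret branch_system m "f ` M" "edge_map f E" T by (rule T)
  note push = adj_edge_map[of E _ _ _ f]
  have "branch_system m M E (\<lambda>a. T (f a))"
  proof
    fix s a b b' assume "s \<in> T (f a)" "adj E s a b" "adj E s a b'"
    then have "f b = f b'" using uniq push by metis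
    then show "b = b'"
      using V \<open>adj E s a b\<close> \<open>adj E s a b'\<close> assms(2) by (meson inj_onD)
  next
    show "dirs m - {opp s} \<subseteq> T (f b)" if "s \<in> T (f a)" "adj E s a b" for s a b
      by (rule child[OF that(1) push[OF that(2)]])
    show "s \<in> T (f a) \<or> opp s \<in> T (f b)" if "adj E s a b" for s a b
      by (rule orient[OF push[OF that]])
    show "t = s" if "adj E s a b" "s \<notin> T (f a)" "t \<in> dirs m - T (f a)" for s t a b
      by (rule single[OF push[OF that(1)] that(2,3)])
    show "dirs m \<subseteq> T (f a)" if "a \<in> M" for a
      by (rule marked) (use that in simp)
  qed
  then show ?thesis by (auto simp: branching_def)
qed

section \<open>Amalgamation over branching structures\<close>

text \<open>Pruning of the fibre product: in the directions \<open>T b\<close> neighbours of the two components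
  automatically lie over the same vertex, so only the exempt direction can obstruct totality.\<close>
fun amalgam :: "nat \<Rightarrow> 'b edges \<Rightarrow> 'c edges \<Rightarrow> ('b \<times> 'c) set \<Rightarrow> ('b \<Rightarrow> (nat \<times> bool) set) \<Rightarrow> nat \<Rightarrow> ('b \<times> 'c) set" where
  "amalgam m B C D T 0 = D"
| "amalgam m B C D T (Suc k) = {(b, c) \<in> D. \<forall>s\<in>dirs m - T b.
     \<exists>b' c'. (b', c') \<in> amalgam m B C D T k \<and> adj B s b b' \<and> adj C s c c'}"

declare amalgam.simps(2) [simp del]

lemma amalgam_Suc_iff: "(b, c) \<in> amalgam m B C D T (Suc k) \<longleftrightarrow> (b, c) \<in> D \<and> (\<forall>s\<in>dirs m - T b.
     \<exists>b' c'. (b', c') \<in> amalgam m B C D T k \<and> adj B s b b' \<and> adj C s c c')"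
  by (simp add: amalgam.simps)

lemma amalgam_subset: "amalgam m B C D T k \<subseteq> D"
  by (cases k) (auto simp: amalgam.simps)

lemma amalgam_decreasing: "amalgam m B C D T (Suc k) \<subseteq> amalgam m B C D T k"
proof (induction k)
  case 0
  show ?case using amalgam_subset by simp
next
  case (Suc k)
  show ?case
  proof (rule subrelI)
    fix b c assume "(b, c) \<in> amalgam m B C D T (Suc (Suc k))"
    then show "(b, c) \<in> amalgam m B C D T (Suc k)"
      using Suc unfolding amalgam_Suc_iff[of b c m B C D T "Suc k"] amalgam_Suc_iff[of b c m B C D T k] by blast
  qed
qed

lemma amalgam_stable:
  assumes "finite D"
  obtains k where "amalgam m B C D T (Suc k) = amalgam m B C D T k"
proof -
  obtain k where k: "\<And>l. card (amalgam m B C D T k) \<le> card (amalgam m B C D T l)"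
    using ex_has_least_nat[of "\<lambda>_. True" 0 "\<lambda>k. card (amalgam m B C D T k)"] by auto
  have "finite (amalgam m B C D T k)"
    using amalgam_subset assms finite_subset by metis
  then have "amalgam m B C D T (Suc k) = amalgam m B C D T k"
    by (rule card_seteq[OF _ amalgam_decreasing k])
  then show ?thesis using that by blast
qed

text \<open>The asymmetry of the projections is intended: \<open>B\<close> is a graph to be realised
  exactly, whereas \<open>C\<close> will be a fine graph of a given tuple, and edges inside
  \<open>C\<close> are enough to stay close to that tuple.\<close>

lemma amalgamation:
  assumes B: "total_graph m VB B" and C: "total_graph m VC C"
    and A: "branching m (\<phi> ` p ` F) A"
    and hom: "edge_map \<phi> B \<subseteq> A" "edge_map \<psi> C \<subseteq> A"
    and onto: "\<phi> ` VB = \<psi> ` VC"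
    and p: "\<And>x. x \<in> F \<Longrightarrow> p x \<in> VB \<and> (\<forall>i<m. (i, p x, p x) \<in> B)"
    and q: "\<And>x. x \<in> F \<Longrightarrow> q x \<in> VC \<and> (\<forall>i<m. (i, q x, q x) \<in> C) \<and> \<psi> (q x) = \<phi> (p x)"
  obtains V E where "total_graph m V E" "\<forall>(b, c)\<in>V. \<phi> b = \<psi> c"
    "snd ` V = VC" "edge_map fst E = B" "edge_map snd E \<subseteq> C"
    "\<forall>x\<in>F. (p x, q x) \<in> V \<and> (\<forall>i<m. (i, (p x, q x), (p x, q x)) \<in> E)"
proof -
  obtain T0 where T0: "branch_system m (\<phi> ` p ` F) A T0"
    using A by (auto simp: branching_def)
  define T where "T = (\<lambda>b. T0 (\<phi> b))"
  have adjB: "adj A s (\<phi> b) (\<phi> b')" if "adj B s b b'" for s b b'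
    using adj_mono[OF hom(1)] adj_edge_map[OF that] by blast
  have adjC: "adj A s (\<psi> c) (\<psi> c')" if "adj C s c c'" for s c c'
    using adj_mono[OF hom(2)] adj_edge_map[OF that] by blast
  note uniq = branch_system.uniq[OF T0] and child = branch_system.child[OF T0]
    and orient = branch_system.orient[OF T0] and single = branch_system.single[OF T0]
  define D where "D = {(b, c) \<in> VB \<times> VC. \<phi> b = \<psi> c}"
  define R where "R = amalgam m B C D T"
  have "finite D"
    by (rule finite_subset[of _ "VB \<times> VC"]) (use B C in \<open>auto simp: D_def total_graph_def\<close>)
  then obtain N where N: "R (Suc N) = R N"
    unfolding R_def using amalgam_stable by blast
  have R_D: "b \<in> VB \<and> c \<in> VC \<and> \<phi> b = \<psi> c" if "(b, c) \<in> R k" for b c k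
    using amalgam_subset that unfolding R_def D_def by blast
  have R_Suc: "(b, c) \<in> R (Suc k) \<longleftrightarrow> (b, c) \<in> D \<and> (\<forall>s\<in>dirs m - T b.
      \<exists>b' c'. (b', c') \<in> R k \<and> adj B s b b' \<and> adj C s c c')" for b c k
    unfolding R_def by (rule amalgam_Suc_iff)
  \<comment> \<open>No pruning stage loses a vertex of \<open>B\<close>. Walk from \<open>b\<close>
    in its exempt direction to \<open>b1\<close>, take a partner \<open>c1\<close> one stage
    earlier, and walk back on the other side: by \<open>orient\<close> the way back is unique below,
    so the endpoint lies over \<open>\<phi> b\<close> and is a partner for \<open>b\<close>.\<close>
  have vertB: "\<exists>c. (b, c) \<in> R k" if "b \<in> VB" for b k
    using that
  proof (induction k arbitrary: b)
    case 0
    then have "\<phi> b \<in> \<psi> ` VC" using onto by blast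
    then show ?case using 0 by (auto simp: R_def D_def)
  next
    case (Suc k)
    show ?case
    proof (cases "dirs m \<subseteq> T b")
      case True
      have "\<phi> b \<in> \<psi> ` VC" using onto Suc by blast
      then obtain c where c: "c \<in> VC" "\<phi> b = \<psi> c" by auto
      then have "(b, c) \<in> R (Suc k)"
        using Suc.prems True by (simp add: R_Suc D_def Diff_eq_empty_iff[THEN iffD2])
      then show ?thesis by blast
    next
      case False
      then obtain s where s: "s \<in> dirs m" "s \<notin> T b" by blast
      obtain b1 where b1: "adj B s b b1" "b1 \<in> VB"
        using total_graph_adjE[OF B Suc.prems s(1)] by blast
      obtain c1 where c1: "(b1, c1) \<in> R k" using Suc.IH[OF b1(2)] by blast
      obtain c where c: "adj C (opp s) c1 c" "c \<in> VC"
        using total_graph_adjE[OF C, of c1 "opp s"] R_D[OF c1] s(1) by auto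
      have "opp s \<in> T0 (\<phi> b1)"
        using orient[OF adjB[OF b1(1)]] s(2) by (simp add: T_def)
      then have "\<psi> c = \<phi> b"
        using uniq[of "opp s" "\<phi> b1"] adjB[OF b1(1)] adjC[OF c(1)] R_D[OF c1] by auto
      moreover have "t = s" if "t \<in> dirs m - T b" for t
        using single[OF adjB[OF b1(1)]] s(2) that by (simp add: T_def)
      ultimately have "(b, c) \<in> R (Suc k)"
        using Suc.prems c b1(1) c1 by (auto simp: R_Suc D_def)
      then show ?thesis by blast
    qed
  qed
  have vertC: "\<exists>b. (b, c) \<in> R k" if "c \<in> VC" for c k
    using that
  proof (induction k arbitrary: c)
    case 0
    then have "\<psi> c \<in> \<phi> ` VB" using onto by blast
    then show ?case using 0 by (auto simp: R_def D_def)
  next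
    case (Suc k)
    show ?case
    proof (cases "dirs m \<subseteq> T0 (\<psi> c)")
      case True
      have "\<psi> c \<in> \<phi> ` VB" using onto Suc by blast
      then obtain b where b: "b \<in> VB" "\<phi> b = \<psi> c" by auto
      then have "(b, c) \<in> R (Suc k)"
        using Suc.prems True by (simp add: R_Suc D_def T_def Diff_eq_empty_iff[THEN iffD2])
      then show ?thesis by blast
    next
      case False
      then obtain s where s: "s \<in> dirs m" "s \<notin> T0 (\<psi> c)" by blast
      obtain c1 where c1: "adj C s c c1" "c1 \<in> VC"
        using total_graph_adjE[OF C Suc.prems s(1)] by blast
      obtain b1 where b1: "(b1, c1) \<in> R k" using Suc.IH[OF c1(2)] by blast
      obtain b where b: "adj B (opp s) b1 b" "b \<in> VB"
        using total_graph_adjE[OF B, of b1 "opp s"] R_D[OF b1] s(1) by auto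
      have "opp s \<in> T0 (\<psi> c1)"
        using orient[OF adjC[OF c1(1)]] s(2) by simp
      then have "\<phi> b = \<psi> c"
        using uniq[of "opp s" "\<psi> c1"] adjC[OF c1(1)] adjB[OF b(1)] R_D[OF b1] by auto
      moreover have "t = s" if "t \<in> dirs m - T0 (\<psi> c)" for t
        using single[OF adjC[OF c1(1)]] s(2) that by simp
      ultimately have "(b, c) \<in> R (Suc k)"
        using Suc.prems b c1(1) b1 by (auto simp: R_Suc D_def T_def)
      then show ?thesis by blast
    qed
  qed
  \<comment> \<open>After a step in a unique direction only the way back can be exempt, and there
    the pair just left is the witness. So the new pair passes one more pruning, which by stability
    changes nothing.\<close>
  have closed: "(b', c') \<in> R N" if "(b, c) \<in> R N" "s \<in> T b" "adj B s b b'" "adj C s c c'" for b c s b' c'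
  proof -
    have eq: "\<phi> b = \<psi> c" using R_D[OF that(1)] by blast
    have "\<phi> b' = \<psi> c'"
      using uniq[of s "\<phi> b"] that(2) adjB[OF that(3)] adjC[OF that(4)] eq by (simp add: T_def)
    moreover have "dirs m - T b' \<subseteq> {opp s}"
      using child[OF _ adjB[OF that(3)]] that(2) by (auto simp: T_def)
    moreover have "\<exists>b1 c1. (b1, c1) \<in> R N \<and> adj B (opp s) b' b1 \<and> adj C (opp s) c' c1"
      using that by (intro exI[of _ b] exI[of _ c]) simp
    ultimately have "(b', c') \<in> R (Suc N)"
      using total_graph_adjD(2)[OF B that(3)] total_graph_adjD(2)[OF C that(4)]
      unfolding R_Suc D_def by blast
    then show ?thesis using N by simp
  qed
  define V where "V = R N"
  define E where "E = {(i, v, w). v \<in> V \<and> w \<in> V \<and> (i, fst v, fst w) \<in> B \<and> (i, snd v, snd w) \<in> C}"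
  have adjE: "adj E s (b, c) (b', c') \<longleftrightarrow> (b, c) \<in> V \<and> (b', c') \<in> V \<and> adj B s b b' \<and> adj C s c c'" for s b c b' c'
    by (auto simp: adj_def E_def)
  have "total_graph m V E"
    unfolding total_graph_def
  proof (intro conjI ballI)
    show "finite V"
      using \<open>finite D\<close> finite_subset[OF amalgam_subset] by (auto simp: V_def R_def)
    show "E \<subseteq> {..<m} \<times> V \<times> V"
      using B by (auto simp: E_def total_graph_def)
    fix v s assume "v \<in> V" "s \<in> dirs m"
    then obtain b c where v: "v = (b, c)" "(b, c) \<in> R N" by (cases v) (auto simp: V_def)
    have "\<exists>b' c'. (b', c') \<in> R N \<and> adj B s b b' \<and> adj C s c c'"
    proof (cases "s \<in> T b")
      case True
      obtain b' c' where "adj B s b b'" "adj C s c c'"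
        using total_graph_adjE[OF B _ \<open>s \<in> dirs m\<close>] total_graph_adjE[OF C _ \<open>s \<in> dirs m\<close>] R_D[OF v(2)] by metis
      then show ?thesis using closed[OF v(2) True] by blast
    next
      case False
      have "(b, c) \<in> R (Suc N)" using N v(2) by simp
      then show ?thesis using False \<open>s \<in> dirs m\<close> unfolding R_Suc by blast
    qed
    then show "\<exists>w. adj E s v w" using v adjE V_def by blast
  qed
  moreover have "\<forall>(b, c)\<in>V. \<phi> b = \<psi> c"
    using R_D by (auto simp: V_def)
  moreover have "snd ` V = VC"
    using vertC R_D by (force simp: V_def)
  moreover have "edge_map fst E = B"
  proof
    show "edge_map fst E \<subseteq> B" by (auto simp: edge_map_def E_def)
    \<comment> \<open>Edges of \<open>B\<close> are lifted from an end at which their direction is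
      unique; \<open>orient\<close> provides such an end.\<close>
    have lift: "\<exists>c c'. adj E s (b, c) (b', c')" if edge: "adj B s b b'" "s \<in> T b" for s b b'
    proof -
      obtain c where c: "(b, c) \<in> R N"
        using vertB total_graph_adjD(1)[OF B edge(1)] by blast
      obtain c' where "adj C s c c'"
        using total_graph_adjE[OF C, of c s] R_D[OF c] total_graph_adjD(3)[OF B edge(1)] by blast
      then show ?thesis
        using closed[OF c edge(2,1)] c edge(1) unfolding adjE V_def by blast
    qed
    show "B \<subseteq> edge_map fst E"
    proof
      fix e assume "e \<in> B"
      then obtain i b b' where e: "e = (i, b, b')" "adj B (i, True) b b'"
        by (cases e) (auto simp: adj_def)
      have "\<exists>c c'. adj E (i, True) (b, c) (b', c')"
      proof (cases "(i, True) \<in> T b")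
        case True
        then show ?thesis using lift e(2) by blast
      next
        case False
        then have "opp (i, True) \<in> T b'"
          using orient[OF adjB[OF e(2)]] by (simp add: T_def)
        then show ?thesis
          using lift[of "opp (i, True)" b' b] e(2) by (metis adj_opp)
      qed
      then show "e \<in> edge_map fst E"
        unfolding e(1) edge_map_def by (force simp: adj_def)
    qed
  qed
  moreover have "edge_map snd E \<subseteq> C"
    by (auto simp: edge_map_def E_def)
  moreover have "\<forall>x\<in>F. (p x, q x) \<in> V \<and> (\<forall>i<m. (i, (p x, q x), (p x, q x)) \<in> E)"
  proof
    fix x assume "x \<in> F"
    then have "(p x, q x) \<in> D" using p q by (auto simp: D_def)
    \<comment> \<open>Marks have no exempt direction, so pruning never removes a pair of
      marks.\<close>
    moreover have "dirs m \<subseteq> T (p x)"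
      using branch_system.marked[OF T0] \<open>x \<in> F\<close> unfolding T_def by blast
    ultimately have "(p x, q x) \<in> R (Suc N)"
      unfolding R_Suc by blast
    then have "(p x, q x) \<in> V" using N by (simp add: V_def)
    then show "(p x, q x) \<in> V \<and> (\<forall>i<m. (i, (p x, q x), (p x, q x)) \<in> E)"
      using p q \<open>x \<in> F\<close> by (simp add: E_def)
  qed
  ultimately show ?thesis by (rule that)
qed

section \<open>Branching covers\<close>

text \<open>The label of a neighbour of a \<open>Cone a t\<close> is chosen once and for all, except in the direction
  \<open>t\<close> towards the apex. \<open>Root a s b\<close> sits over \<open>a\<close> and uses the given edge to \<open>b\<close> in
  direction \<open>s\<close>; these provide the missing neighbours of the cones.\<close>
datatype 'v cover = Root 'v "nat \<times> bool" 'v | Cone 'v "nat \<times> bool" | Mark "nat \<Rightarrow> bool"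

text \<open>A walk through cones always exempts the direction back to where it came from, so the
  finitely many pairs of a vertex and a direction suffice to keep track of it. Edges are exactly
  those forced from one of their ends.\<close>

lemma branching_cover:
  fixes E :: "'v edges" and p :: "(nat \<Rightarrow> bool) \<Rightarrow> 'v"
  assumes E: "total_graph m V E" and F: "finite F" and m: "m > 0"
    and p: "\<And>x. x \<in> F \<Longrightarrow> p x \<in> V \<and> (\<forall>i<m. (i, p x, p x) \<in> E)"
  obtains V' and E' :: "'v cover edges" and \<delta> d where "total_graph m V' E'" "\<delta> ` V' = V" "edge_map \<delta> E' \<subseteq> E"
    "\<And>x. x \<in> F \<Longrightarrow> d x \<in> V' \<and> \<delta> (d x) = p x \<and> (\<forall>i<m. (i, d x, d x) \<in> E')"
    "branching m (d ` F) E'"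
proof -
  define f where "f = (\<lambda>a s. SOME b. adj E s a b)"
  have f: "adj E s a (f a s)" if "a \<in> V" "s \<in> dirs m" for a s
    unfolding f_def by (rule someI_ex) (use total_graph_adjE[OF E that] in blast)
  define V' where "V' = {Root a s b | a s b. adj E s a b} \<union> (\<lambda>(a, t). Cone a t) ` (V \<times> dirs m) \<union> Mark ` F"
  define \<delta> where "\<delta> = (\<lambda>v. case v of Root a s b \<Rightarrow> a | Cone a t \<Rightarrow> a | Mark x \<Rightarrow> p x)"
  define T where "T = (\<lambda>v :: 'v cover. case v of Root a s b \<Rightarrow> dirs m | Cone a t \<Rightarrow> dirs m - {t} | Mark x \<Rightarrow> dirs m)"
  define nx where "nx = (\<lambda>s v. case v of Root a t b \<Rightarrow> Cone (if s = t then b else f a s) (opp s)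
    | Cone a t \<Rightarrow> Cone (f a s) (opp s) | Mark x \<Rightarrow> Mark x)"
  have Cone_V': "Cone a t \<in> V' \<longleftrightarrow> a \<in> V \<and> t \<in> dirs m" for a t
    by (auto simp: V'_def)
  have Root_V': "Root a s b \<in> V' \<longleftrightarrow> adj E s a b" for a s b
    by (auto simp: V'_def simp del: split_paired_Ex)
  have nx_V': "nx s v \<in> V' \<and> adj E s (\<delta> v) (\<delta> (nx s v))" if "v \<in> V'" "s \<in> dirs m" for s v
  proof (cases v)
    case (Root a t b)
    then have "adj E t a b" using that(1) by (auto simp: V'_def)
    then have "a \<in> V" "b \<in> V" using total_graph_adjD[OF E] by blast+
    then show ?thesis
      using Root that(2) f[of a s] total_graph_adjD(2)[OF E] \<open>adj E t a b\<close> by (auto simp: nx_def Cone_V' \<delta>_def)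
  next
    case (Cone a t)
    then have "a \<in> V" using that(1) by (auto simp: V'_def)
    then show ?thesis
      using Cone that(2) f[of a s] total_graph_adjD(2)[OF E] by (auto simp: nx_def Cone_V' \<delta>_def)
  next
    case (Mark x)
    then show ?thesis using that p by (auto simp: nx_def V'_def \<delta>_def adj_def dirs_def)
  qed
  define E' where "E' = {(i, v, w). i < m \<and> v \<in> V' \<and> w \<in> V' \<and>
    ((i, True) \<in> T v \<and> w = nx (i, True) v \<or> (i, False) \<in> T w \<and> v = nx (i, False) w)}"
  have adj: "adj E' s v w \<longleftrightarrow> s \<in> dirs m \<and> v \<in> V' \<and> w \<in> V' \<and>
      (s \<in> T v \<and> w = nx s v \<or> opp s \<in> T w \<and> v = nx (opp s) w)" for s v w
    by (cases s; cases "snd s") (auto simp: adj_def E'_def dirs_def opp_def)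
  \<comment> \<open>An edge forced from the end \<open>w\<close> arrives at a cone that exempts
    \<open>s\<close>, or is a loop at a mark. Hence \<open>s \<in> T v\<close> makes the edge the
    one chosen at \<open>v\<close>.\<close>
  have det: "w = nx s v" if "adj E' s v w" "s \<in> T v" for s v w
    using that unfolding adj by (cases w) (auto simp: T_def nx_def)
  have "finite V'"
  proof -
    have fin: "finite V" "finite (dirs m)"
      using E by (simp_all add: total_graph_def dirs_def)
    have "finite {Root a s b | a s b. adj E s a b}"
    proof (rule finite_subset)
      show "{Root a s b | a s b. adj E s a b} \<subseteq> (\<lambda>(a, s, b). Root a s b) ` (V \<times> dirs m \<times> V)"
        using total_graph_adjD[OF E] by force
    qed (use fin in simp)
    moreover have "finite ((\<lambda>(a, t). Cone a t) ` (V \<times> dirs m))"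
      using fin by simp
    ultimately show ?thesis using F by (simp add: V'_def)
  qed
  have "total_graph m V' E'"
    unfolding total_graph_def
  proof (intro conjI ballI)
    show "E' \<subseteq> {..<m} \<times> V' \<times> V'" by (auto simp: E'_def)
    fix v s assume v: "v \<in> V'" and s: "s \<in> dirs m"
    show "\<exists>w. adj E' s v w"
    proof (cases "s \<in> T v")
      case True
      then show ?thesis using nx_V'[OF v s] v s unfolding adj by blast
    next
      case False
      then obtain a where a: "v = Cone a s" using s by (cases v) (auto simp: T_def)
      then have "a \<in> V" using v by (auto simp: V'_def)
      then obtain b where "adj E s a b" using total_graph_adjE[OF E _ s] by blast
      \<comment> \<open>In its special direction this root leads to
        \<open>Cone a (opp (opp s))\<close>, which is \<open>v\<close>; so it supplies a neighbour
        in the exempt direction.\<close>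
      then have "Root b (opp s) a \<in> V'" by (simp add: Root_V')
      then have "adj E' s v (Root b (opp s) a)"
        unfolding adj using v s a by (auto simp: T_def nx_def)
      then show ?thesis by blast
    qed
  qed (rule \<open>finite V'\<close>)
  moreover have "\<delta> ` V' = V"
  proof
    show "\<delta> ` V' \<subseteq> V"
      using total_graph_adjD[OF E] p by (auto simp: V'_def \<delta>_def)
    show "V \<subseteq> \<delta> ` V'"
    proof
      fix a assume "a \<in> V"
      then have "Cone a (0, True) \<in> V'" using m by (simp add: Cone_V' dirs_def)
      then show "a \<in> \<delta> ` V'" by (force simp: \<delta>_def)
    qed
  qed
  moreover have "edge_map \<delta> E' \<subseteq> E"
  proof -
    have "(i, \<delta> v, \<delta> w) \<in> E" if "(i, v, w) \<in> E'" for i v w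
    proof -
      have "i < m" "v \<in> V'" "w \<in> V'"
        using that by (auto simp: E'_def)
      then have "adj E (i, True) (\<delta> v) (\<delta> (nx (i, True) v))" "adj E (i, False) (\<delta> w) (\<delta> (nx (i, False) w))"
        using nx_V' by (auto simp: dirs_def)
      then show ?thesis
        using that by (auto simp: E'_def adj_def)
    qed
    then show ?thesis by (auto simp: edge_map_def)
  qed
  moreover have "Mark x \<in> V' \<and> \<delta> (Mark x) = p x \<and> (\<forall>i<m. (i, Mark x, Mark x) \<in> E')" if "x \<in> F" for x
    using that by (auto simp: V'_def \<delta>_def E'_def T_def nx_def dirs_def)
  moreover have "branching m (Mark ` F) E'"
    unfolding branching_def
  proof (intro exI[of _ T], unfold_locales)
    show "w = w'" if "s \<in> T v" "adj E' s v w" "adj E' s v w'" for s v w w'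
      using det that by blast
    show "dirs m - {opp s} \<subseteq> T w" if "s \<in> T v" "adj E' s v w" for s v w
      using det[OF that(2,1)] by (cases v) (auto simp: nx_def T_def)
    show "s \<in> T v \<or> opp s \<in> T w" if "adj E' s v w" for s v w
      using that unfolding adj by blast
    show "t = s" if "adj E' s v w" "s \<notin> T v" "t \<in> dirs m - T v" for s t v w
      using that unfolding adj by (cases v) (auto simp: T_def)
    show "dirs m \<subseteq> T v" if "v \<in> Mark ` F" for v
      using that by (auto simp: T_def)
  qed
  ultimately show ?thesis using that by blast
qed

section \<open>Generic tuples\<close>

lemma Homeo_comp: "f \<in> Homeo \<Longrightarrow> g \<in> Homeo \<Longrightarrow> f \<circ> g \<in> Homeo"
  unfolding Homeo_def using homeomorphic_map_compose by blast

lemma Homeo_inv: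
  assumes "g \<in> Homeo" shows "inv g \<in> Homeo"
proof -
  obtain f where f: "homeomorphic_maps cantor_top cantor_top g f"
    using assms by (auto simp: Homeo_def homeomorphic_map_maps)
  have "inv g = f"
    by (rule inv_equality) (use f in \<open>auto simp: homeomorphic_maps_def\<close>)
  moreover have "homeomorphic_map cantor_top cantor_top f"
    using f homeomorphic_maps_sym homeomorphic_map_maps by blast
  ultimately show ?thesis by (simp add: Homeo_def)
qed

lemma id_in_fixing: "id \<in> fixing F"
  by (auto simp: fixing_def Homeo_def homeomorphic_map_id[unfolded id_def[symmetric]])

lemma fixing_conj:
  assumes "g \<in> fixing F" "h \<in> fixing F"
  shows "inv g \<circ> h \<circ> g \<in> fixing F"
proof -
  have "inv g p = p" if "p \<in> F" for p
    using assms(1) that Homeo_bij bij_is_inj by (auto simp: fixing_def intro: inv_f_eq)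
  then show ?thesis
    using assms Homeo_comp Homeo_inv by (auto simp: fixing_def)
qed

definition induced :: "nat \<Rightarrow> ((nat \<Rightarrow> bool) \<Rightarrow> 'v) \<Rightarrow> (nat \<Rightarrow> (nat \<Rightarrow> bool) \<Rightarrow> nat \<Rightarrow> bool) \<Rightarrow> 'v edges" where
  "induced m \<rho> h = {(i, \<rho> y, \<rho> (h i y)) | i y. i < m}"

lemma induced_comp: "induced m (\<lambda>y. f (\<rho> y)) h = edge_map f (induced m \<rho> h)"
  by (force simp: induced_def edge_map_def)

text \<open>With at least one relation the edges know the vertices, so equality of induced graphs
  carries equality of the label sets with it.\<close>

lemma vertices_induced: "m > 0 \<Longrightarrow> range \<rho> = (\<lambda>(i, a, b). a) ` induced m \<rho> h"
  by (force simp: induced_def)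

section \<open>Meagre sets and countability of the set of partitions\<close>

lemma nowhere_dense_compl:
  assumes "openin X U" and dense: "\<And>W. openin X W \<Longrightarrow> W \<noteq> {} \<Longrightarrow> W \<inter> U \<noteq> {}"
  shows "nowhere_dense_in X (topspace X - U)"
proof -
  have "X closure_of (topspace X - U) = topspace X - U"
    using assms(1) by (simp add: closedin_diff closure_of_closedin)
  moreover have "X interior_of (topspace X - U) \<inter> U = {}"
    using interior_of_subset by fastforce
  ultimately show ?thesis
    using dense[of "X interior_of (topspace X - U)"] by (auto simp: nowhere_dense_in_def)
qed

lemma meagre_compl_INT:
  assumes I: "countable I" "I \<noteq> {}"
    and U: "\<And>i. i \<in> I \<Longrightarrow> openin X (U i)"
    and dense: "\<And>i W. i \<in> I \<Longrightarrow> openin X W \<Longrightarrow> W \<noteq> {} \<Longrightarrow> W \<inter> U i \<noteq> {}"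
    and S: "S \<subseteq> topspace X" "S \<inter> (\<Inter>i\<in>I. U i) = {}"
  shows "meagre_in X S"
proof -
  define N where "N = (\<lambda>k. topspace X - U (from_nat_into I k))"
  have "nowhere_dense_in X (N k)" for k
    unfolding N_def using from_nat_into[OF I(2)] U dense by (intro nowhere_dense_compl) auto
  moreover have "S \<subseteq> (\<Union>k. N k)"
  proof
    fix x assume "x \<in> S"
    then obtain i where "i \<in> I" "x \<notin> U i" using S by blast
    then obtain k where "x \<notin> U (from_nat_into I k)"
      using from_nat_into_surj[OF I(1)] by metis
    then show "x \<in> (\<Union>k. N k)" using \<open>x \<in> S\<close> S by (auto simp: N_def)
  qed
  ultimately show ?thesis using S by (auto simp: meagre_in_def)
qed

text \<open>A modulus and the finite list of values on the cylinders of that depth code the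
  function.\<close>

lemma countable_locally_const: "countable {\<rho> :: (nat \<Rightarrow> bool) \<Rightarrow> nat. locally_const \<rho>}"
proof -
  define W where "W = (\<lambda>k. SOME ws. set ws = range (prefix_of k))"
  have W: "set (W k) = range (prefix_of k)" for k
    unfolding W_def by (rule someI_ex) (use finite_list[OF finite_range_prefix_of] in blast)
  define D where "D = (\<lambda>(k, vs) y. the (map_of (zip (W k) vs) (prefix_of k y)) :: nat)"
  have "{\<rho>. locally_const \<rho>} \<subseteq> range D"
  proof
    fix \<rho> :: "(nat \<Rightarrow> bool) \<Rightarrow> nat" assume "\<rho> \<in> {\<rho>. locally_const \<rho>}"
    then obtain k f where f: "\<And>y. \<rho> y = f (prefix_of k y)"
      using locally_const_factor by (metis mem_Collect_eq)
    have "D (k, map f (W k)) = \<rho>"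
      using W by (auto simp: D_def f map_of_zip_map)
    then show "\<rho> \<in> range D" by blast
  qed
  moreover have "countable (range D)" by simp
  ultimately show ?thesis by (rule countable_subset)
qed

section \<open>The space of tuples fixing the marked points\<close>

locale marked_tuples =
  fixes F :: "(nat \<Rightarrow> bool) set" and m :: nat
  assumes F: "finite F" and m: "m > 0"
begin

abbreviation tuples :: "(nat \<Rightarrow> (nat \<Rightarrow> bool) \<Rightarrow> nat \<Rightarrow> bool) set" where
  "tuples \<equiv> {..<m} \<rightarrow>\<^sub>E fixing F"

abbreviation tuples_top :: "(nat \<Rightarrow> (nat \<Rightarrow> bool) \<Rightarrow> nat \<Rightarrow> bool) topology" where
  "tuples_top \<equiv> product_topology (\<lambda>_. fixing_top F) {..<m}"

definition nbhd :: "(nat \<Rightarrow> (nat \<Rightarrow> bool) \<Rightarrow> nat \<Rightarrow> bool) \<Rightarrow> nat \<Rightarrow> (nat \<Rightarrow> (nat \<Rightarrow> bool) \<Rightarrow> nat \<Rightarrow> bool) set" where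
  "nbhd h k = {h' \<in> tuples. \<forall>i<m. \<forall>y. agree k (h' i y) (h i y)}"

lemma topspace_tuples_top: "topspace tuples_top = tuples"
  by (simp only: topspace_product_topology topspace_fixing_top)

lemma tuples_D: "h \<in> tuples \<Longrightarrow> i < m \<Longrightarrow> h i \<in> fixing F"
  by auto

lemma tuples_bij: "h \<in> tuples \<Longrightarrow> i < m \<Longrightarrow> bij (h i)"
  using tuples_D Homeo_bij by (auto simp: fixing_def)

lemma tuples_fix: "h \<in> tuples \<Longrightarrow> i < m \<Longrightarrow> p \<in> F \<Longrightarrow> h i p = p"
  using tuples_D by (auto simp: fixing_def)

lemma openin_tuples_iff:
  assumes "S \<subseteq> tuples"
  shows "openin tuples_top S \<longleftrightarrow> (\<forall>h\<in>S. \<exists>k. nbhd h k \<subseteq> S)"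
proof
  assume S: "openin tuples_top S"
  show "\<forall>h\<in>S. \<exists>k. nbhd h k \<subseteq> S"
  proof
    fix h assume "h \<in> S"
    with S obtain U where U: "\<forall>i\<in>{..<m}. openin (fixing_top F) (U i)" "h \<in> Pi\<^sub>E {..<m} U" "Pi\<^sub>E {..<m} U \<subseteq> S"
      unfolding openin_product_topology_alt by blast
    have "\<forall>i. \<exists>k. i < m \<longrightarrow> (\<forall>g'\<in>fixing F. (\<forall>y. agree k (g' y) (h i y)) \<longrightarrow> g' \<in> U i)"
      using openin_fixing_imp_nbhd U(1,2) by (meson PiE_mem lessThan_iff)
    then obtain k where k: "\<And>i g'. i < m \<Longrightarrow> g' \<in> fixing F \<Longrightarrow> (\<And>y. agree (k i) (g' y) (h i y)) \<Longrightarrow> g' \<in> U i"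
      by metis
    have "nbhd h (\<Sum>i<m. k i) \<subseteq> Pi\<^sub>E {..<m} U"
    proof
      fix h' assume h': "h' \<in> nbhd h (\<Sum>i<m. k i)"
      have "h' i \<in> U i" if "i < m" for i
      proof -
        have "k i \<le> (\<Sum>i<m. k i)" using that by (auto intro: member_le_sum)
        then show ?thesis
          using h' that by (intro k) (auto simp: nbhd_def intro: agree_mono)
      qed
      then show "h' \<in> Pi\<^sub>E {..<m} U" using h' by (auto simp: nbhd_def PiE_iff)
    qed
    then show "\<exists>k. nbhd h k \<subseteq> S" using U(3) by blast
  qed
next
  assume S: "\<forall>h\<in>S. \<exists>k. nbhd h k \<subseteq> S"
  have op: "openin tuples_top (nbhd h k)" if "h \<in> tuples" for h k
  proof -
    have "nbhd h k = Pi\<^sub>E {..<m} (\<lambda>i. {g \<in> fixing F. \<forall>y. agree k (g y) (h i y)})"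
      unfolding nbhd_def by (intro set_eqI) (simp add: PiE_iff, blast)
    then show ?thesis
      using that openin_fixing_nbhd tuples_D by (simp add: openin_PiE)
  qed
  show "openin tuples_top S"
  proof (subst openin_subopen, intro ballI)
    fix h assume "h \<in> S"
    then obtain k where "nbhd h k \<subseteq> S" using S by blast
    moreover have "h \<in> nbhd h k" using \<open>h \<in> S\<close> assms by (auto simp: nbhd_def)
    moreover have "openin tuples_top (nbhd h k)" using op \<open>h \<in> S\<close> assms by blast
    ultimately show "\<exists>T. openin tuples_top T \<and> h \<in> T \<and> T \<subseteq> S"
      by (intro exI[of _ "nbhd h k"]) simp
  qed
qed

lemma total_induced:
  assumes "h \<in> tuples" "locally_const \<rho>"
  shows "total_graph m (range \<rho>) (induced m \<rho> h)"
  unfolding total_graph_def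
proof (intro conjI ballI)
  show "finite (range \<rho>)" using assms(2) by (rule finite_range_locally_const)
  show "induced m \<rho> h \<subseteq> {..<m} \<times> range \<rho> \<times> range \<rho>" by (auto simp: induced_def)
  fix a s assume "a \<in> range \<rho>" "s \<in> dirs m"
  then obtain y i b where y: "a = \<rho> y" "s = (i, b)" "i < m" by (auto simp: dirs_def)
  obtain z where "h i z = y" using tuples_bij[OF assms(1) y(3)] by (metis bij_pointE)
  then show "\<exists>b. adj (induced m \<rho> h) s a b"
    using y by (cases b) (auto simp: adj_def induced_def)
qed

lemma induced_mark:
  assumes "h \<in> tuples" "p \<in> F" "i < m"
  shows "(i, \<rho> p, \<rho> p) \<in> induced m \<rho> h"
proof -
  have "(i, \<rho> p, \<rho> (h i p)) \<in> induced m \<rho> h"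
    unfolding induced_def using assms(3) by blast
  then show ?thesis using tuples_fix[OF assms(1,3,2)] by simp
qed

text \<open>Edges depend on values only through their cells, so small perturbations leave the graph
  unchanged. Openness of the two generic conditions rests on this.\<close>

lemma induced_nbhd:
  assumes "locally_const \<rho>"
  obtains k where "\<And>h'. h' \<in> nbhd h k \<Longrightarrow> induced m \<rho> h' = induced m \<rho> h"
proof -
  obtain k where k: "\<forall>y z. agree k y z \<longrightarrow> \<rho> y = \<rho> z"
    using assms by (auto simp: locally_const_def)
  have "induced m \<rho> h' = induced m \<rho> h" if "h' \<in> nbhd h k" for h'
  proof -
    have "\<rho> (h' i y) = \<rho> (h i y)" if "i < m" for i y
      using \<open>h' \<in> nbhd h k\<close> that k by (auto simp: nbhd_def)
    then show ?thesis unfolding induced_def by force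
  qed
  then show ?thesis using that by blast
qed

lemma tuples_uniform:
  assumes "h \<in> tuples"
  obtains l where "l \<ge> l0" "\<And>i y z. i < m \<Longrightarrow> agree l y z \<Longrightarrow> agree k (h i y) (h i z)"
proof -
  have "\<forall>i. \<exists>l. i < m \<longrightarrow> (\<forall>y z. agree l y z \<longrightarrow> agree k (h i y) (h i z))"
    using Homeo_uniform tuples_D[OF assms] unfolding fixing_def by blast
  then obtain l where l: "\<And>i y z. i < m \<Longrightarrow> agree (l i) y z \<Longrightarrow> agree k (h i y) (h i z)"
    by metis
  have "agree k (h i y) (h i z)" if "i < m" "agree (l0 + (\<Sum>i<m. l i)) y z" for i y z
  proof -
    have "l i \<le> (\<Sum>i<m. l i)" using that by (auto intro: member_le_sum)
    then have "l i \<le> l0 + (\<Sum>i<m. l i)" by simp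
    then show ?thesis using that l agree_mono by blast
  qed
  then show ?thesis using that[of "l0 + (\<Sum>i<m. l i)"] by simp
qed

section \<open>Realising abstract graphs by homeomorphisms\<close>

lemma realize_relation:
  assumes \<rho>: "locally_const \<rho>" and R: "fst ` R = range \<rho>" "snd ` R = range \<rho>" "finite R"
    and marks: "\<And>p. p \<in> F \<Longrightarrow> (\<rho> p, \<rho> p) \<in> R"
  obtains g where "g \<in> fixing F" "range (\<lambda>y. (\<rho> y, \<rho> (g y))) = R"
proof -
  \<comment> \<open>The cells are split twice: \<open>u\<close> assigns to a point an edge starting
    in its cell, \<open>v\<close> an edge ending there. A homeomorphism carrying \<open>u\<close> to
    \<open>v\<close> follows the edges, and since \<open>u\<close> is onto \<open>R\<close>, every
    edge is used.\<close>
  obtain u where u: "locally_const u" "range u = R" "\<And>y. fst (u y) = \<rho> y" "\<And>p. p \<in> F \<Longrightarrow> u p = (\<rho> p, \<rho> p)"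
    by (rule locally_const_lift[OF \<rho> F R(3,1), of "\<lambda>p. (\<rho> p, \<rho> p)"]) (simp_all add: marks)
  obtain v where v: "locally_const v" "range v = R" "\<And>y. snd (v y) = \<rho> y" "\<And>p. p \<in> F \<Longrightarrow> v p = (\<rho> p, \<rho> p)"
    by (rule locally_const_lift[OF \<rho> F R(3,2), of "\<lambda>p. (\<rho> p, \<rho> p)"]) (simp_all add: marks)
  obtain g where g: "g \<in> fixing F" "\<And>y. v (g y) = u y"
    by (rule fixing_homogeneous[OF F u(1) v(1)]) (simp_all add: u v)
  have "(\<rho> y, \<rho> (g y)) = u y" for y
    using u(3) v(3) g(2) by (metis prod.collapse)
  then show ?thesis using that g(1) u(2) by simp
qed

text \<open>Two depths are needed. If the new edge at \<open>y\<close> lies over an edge of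
  \<open>h\<close> at the cylinders of depth \<open>l\<close>, some \<open>z\<close> in the
  \<open>l\<close>-cylinder of \<open>y\<close> has \<open>h i z\<close> close to
  \<open>h' i y\<close>, and the choice of \<open>l\<close> makes \<open>h i z\<close> and
  \<open>h i y\<close> agree in \<open>k\<close> bits.\<close>

lemma realize:
  assumes h: "h \<in> tuples" and l: "k \<le> l" "\<And>i y z. i < m \<Longrightarrow> agree l y z \<Longrightarrow> agree k (h i y) (h i z)"
    and E: "total_graph m V E" and \<delta>: "\<delta> ` V = range (prefix_of l)" "edge_map \<delta> E \<subseteq> induced m (prefix_of l) h"
    and d: "\<And>p. p \<in> F \<Longrightarrow> d p \<in> V \<and> \<delta> (d p) = prefix_of l p \<and> (\<forall>i<m. (i, d p, d p) \<in> E)"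
  obtains h' \<rho> where "h' \<in> nbhd h k" "locally_const \<rho>" "range \<rho> = V" "\<And>y. \<delta> (\<rho> y) = prefix_of l y"
    "induced m \<rho> h' = E" "\<And>p. p \<in> F \<Longrightarrow> \<rho> p = d p"
proof -
  have "finite V" using E by (simp add: total_graph_def)
  obtain \<rho> where \<rho>: "locally_const \<rho>" "range \<rho> = V" "\<And>y. \<delta> (\<rho> y) = prefix_of l y" "\<And>p. p \<in> F \<Longrightarrow> \<rho> p = d p"
    using locally_const_lift[OF locally_const_prefix_of F \<open>finite V\<close> \<delta>(1), of d] d by metis
  define R where "R = (\<lambda>i. {(a, b). (i, a, b) \<in> E})"
  have "\<exists>g. g \<in> fixing F \<and> range (\<lambda>y. (\<rho> y, \<rho> (g y))) = R i" if "i < m" for i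
  proof -
    have sub: "R i \<subseteq> V \<times> V" using E by (auto simp: R_def total_graph_def)
    have total: "\<exists>b. adj E s a b" if "a \<in> V" "s \<in> dirs m" for a s
      using E that by (simp add: total_graph_def)
    have dom: "a \<in> fst ` R i" and ran: "a \<in> snd ` R i" if "a \<in> V" for a
      using total[OF that, of "(i, True)"] total[OF that, of "(i, False)"] \<open>i < m\<close>
      by (force simp: R_def adj_def dirs_def)+
    have onto: "fst ` R i = range \<rho>" "snd ` R i = range \<rho>"
      unfolding \<rho>(2) using sub dom ran by auto
    have fin: "finite (R i)"
      using sub \<open>finite V\<close> finite_subset by blast
    have "(\<rho> p, \<rho> p) \<in> R i" if "p \<in> F" for p
      using d[OF that] \<rho>(4)[OF that] \<open>i < m\<close> by (simp add: R_def)
    from realize_relation[OF \<rho>(1) onto fin this] show ?thesis by blast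
  qed
  then obtain g where g: "\<And>i. i < m \<Longrightarrow> g i \<in> fixing F" "\<And>i. i < m \<Longrightarrow> range (\<lambda>y. (\<rho> y, \<rho> (g i y))) = R i"
    by metis
  define h' where "h' = restrict g {..<m}"
  have "h' \<in> tuples" using g(1) by (auto simp: h'_def)
  have ind: "induced m \<rho> h' = E"
  proof (rule set_eqI)
    fix e :: "nat \<times> 'a \<times> 'a"
    obtain i a b where e: "e = (i, a, b)" by (cases e)
    have "e \<in> induced m \<rho> h' \<longleftrightarrow> i < m \<and> (a, b) \<in> range (\<lambda>y. (\<rho> y, \<rho> (g i y)))"
      unfolding e induced_def h'_def by auto
    also have "\<dots> \<longleftrightarrow> i < m \<and> (i, a, b) \<in> E"
      using g(2)[of i] by (auto simp: R_def)
    also have "\<dots> \<longleftrightarrow> e \<in> E"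
      unfolding e using E by (auto simp: total_graph_def)
    finally show "e \<in> induced m \<rho> h' \<longleftrightarrow> e \<in> E" .
  qed
  have "agree k (h' i y) (h i y)" if "i < m" for i y
  proof -
    have "(i, \<rho> y, \<rho> (h' i y)) \<in> E"
      unfolding ind[symmetric] using that by (auto simp: induced_def)
    then have "(i, \<delta> (\<rho> y), \<delta> (\<rho> (h' i y))) \<in> induced m (prefix_of l) h"
      using \<delta>(2) by (force simp: edge_map_def)
    then obtain z where "prefix_of l y = prefix_of l z" "prefix_of l (h' i y) = prefix_of l (h i z)"
      unfolding \<rho>(3) by (auto simp: induced_def)
    then have "agree l z y" "agree k (h' i y) (h i z)"
      using l(1) agree_mono agree_sym unfolding prefix_of_eq_iff by blast+
    then show ?thesis using l(2)[OF that] agree_trans by blast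
  qed
  then have "h' \<in> nbhd h k" using \<open>h' \<in> tuples\<close> by (simp add: nbhd_def)
  then show ?thesis using that \<rho> ind by blast
qed

section \<open>The generic conditions: openness and density\<close>

definition has_branching_refinement :: "((nat \<Rightarrow> bool) \<Rightarrow> nat) \<Rightarrow> (nat \<Rightarrow> (nat \<Rightarrow> bool) \<Rightarrow> nat \<Rightarrow> bool) set" where
  "has_branching_refinement \<pi> = {h \<in> tuples. \<exists>\<rho> :: (nat \<Rightarrow> bool) \<Rightarrow> nat. locally_const \<rho> \<and>
     (\<forall>y z. \<rho> y = \<rho> z \<longrightarrow> \<pi> y = \<pi> z) \<and> branching m (\<rho> ` F) (induced m \<rho> h)}"

lemma has_branching_refinementI:
  fixes \<rho> :: "(nat \<Rightarrow> bool) \<Rightarrow> nat"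
  assumes "h \<in> tuples" "locally_const \<rho>" "\<And>y z. \<rho> y = \<rho> z \<Longrightarrow> \<pi> y = \<pi> z"
    "branching m (\<rho> ` F) (induced m \<rho> h)"
  shows "h \<in> has_branching_refinement \<pi>"
  unfolding has_branching_refinement_def mem_Collect_eq
  by (intro conjI exI[of _ \<rho>] allI impI) (fact assms)+

lemma has_branching_refinementE:
  assumes "h \<in> has_branching_refinement \<pi>"
  obtains \<rho> :: "(nat \<Rightarrow> bool) \<Rightarrow> nat" where "locally_const \<rho>" "\<And>y z. \<rho> y = \<rho> z \<Longrightarrow> \<pi> y = \<pi> z"
    "branching m (\<rho> ` F) (induced m \<rho> h)"
  using assms unfolding has_branching_refinement_def mem_Collect_eq by (elim conjE exE) iprover

text \<open>The cells of a refinement are numbered by \<open>prod_encode (a, b)\<close> with \<open>a\<close> the number of the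
  coarser cell. With this fixed projection the extension conditions form a countable family.\<close>
abbreviation coarsen :: "nat \<Rightarrow> nat" where
  "coarsen a \<equiv> fst (prod_decode a)"

text \<open>The guards sit inside the set, so that it is dense for all locally constant
  \<open>\<pi>\<close> and \<open>u\<close> and every \<open>E\<close>. The tuple \<open>h0\<close>
  certifies that \<open>E\<close> is the graph of some tuple, and \<open>u\<close> prescribes the
  labels of the marks.\<close>

definition has_extension ::
    "((nat \<Rightarrow> bool) \<Rightarrow> nat) \<Rightarrow> ((nat \<Rightarrow> bool) \<Rightarrow> nat) \<Rightarrow> nat edges \<Rightarrow> (nat \<Rightarrow> (nat \<Rightarrow> bool) \<Rightarrow> nat \<Rightarrow> bool) set" where
  "has_extension \<pi> u E = {h \<in> tuples.
     (\<exists>h0\<in>tuples. E = induced m u h0) \<longrightarrow> (\<forall>p\<in>F. coarsen (u p) = \<pi> p) \<longrightarrow>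
     induced m \<pi> h = edge_map coarsen E \<longrightarrow> branching m (\<pi> ` F) (induced m \<pi> h) \<longrightarrow>
     (\<exists>v. locally_const v \<and> (\<forall>y. coarsen (v y) = \<pi> y) \<and> induced m v h = E \<and> (\<forall>p\<in>F. v p = u p))}"

lemma open_has_branching_refinement: "openin tuples_top (has_branching_refinement \<pi>)"
proof -
  have "\<exists>k. nbhd h k \<subseteq> has_branching_refinement \<pi>" if h: "h \<in> has_branching_refinement \<pi>" for h
  proof -
    obtain \<rho> :: "(nat \<Rightarrow> bool) \<Rightarrow> nat" where \<rho>: "locally_const \<rho>" "\<And>y z. \<rho> y = \<rho> z \<Longrightarrow> \<pi> y = \<pi> z"
      "branching m (\<rho> ` F) (induced m \<rho> h)"
      by (rule has_branching_refinementE[OF h]) blast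
    obtain k where k: "\<And>h'. h' \<in> nbhd h k \<Longrightarrow> induced m \<rho> h' = induced m \<rho> h"
      using induced_nbhd[OF \<rho>(1)] by blast
    have "h' \<in> has_branching_refinement \<pi>" if "h' \<in> nbhd h k" for h'
      by (rule has_branching_refinementI[OF _ \<rho>(1,2)])
        (use that k[OF that] \<rho>(3) in \<open>auto simp: nbhd_def\<close>)
    then show ?thesis by blast
  qed
  then show ?thesis
    by (subst openin_tuples_iff) (auto simp: has_branching_refinement_def)
qed

text \<open>A witness \<open>v\<close> survives small perturbations. Without a witness some guard
  fails at \<open>h\<close>, and guards see \<open>h\<close> only through its graph on
  \<open>\<pi>\<close>, which is locally constant.\<close>

lemma open_has_extension:
  assumes "locally_const \<pi>"
  shows "openin tuples_top (has_extension \<pi> u E)"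
proof -
  have "\<exists>k. nbhd h k \<subseteq> has_extension \<pi> u E" if h: "h \<in> has_extension \<pi> u E" for h
  proof (cases "\<exists>v. locally_const v \<and> (\<forall>y. coarsen (v y) = \<pi> y) \<and> induced m v h = E \<and> (\<forall>p\<in>F. v p = u p)")
    case True
    then obtain v where v: "locally_const v" "\<forall>y. coarsen (v y) = \<pi> y" "induced m v h = E" "\<forall>p\<in>F. v p = u p"
      by blast
    obtain k where k: "\<And>h'. h' \<in> nbhd h k \<Longrightarrow> induced m v h' = induced m v h"
      using induced_nbhd[OF v(1)] by blast
    have "h' \<in> has_extension \<pi> u E" if "h' \<in> nbhd h k" for h'
    proof -
      have "induced m v h' = E" "h' \<in> tuples" using k v(3) that by (auto simp: nbhd_def)
      then show ?thesis using v unfolding has_extension_def by blast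
    qed
    then show ?thesis by blast
  next
    case False
    obtain k where k: "\<And>h'. h' \<in> nbhd h k \<Longrightarrow> induced m \<pi> h' = induced m \<pi> h"
      using induced_nbhd[OF assms] by blast
    have "h' \<in> has_extension \<pi> u E" if "h' \<in> nbhd h k" for h'
    proof -
      have "h' \<in> tuples" "induced m \<pi> h' = induced m \<pi> h" using k that by (auto simp: nbhd_def)
      then show ?thesis using h False unfolding has_extension_def by simp
    qed
    then show ?thesis by blast
  qed
  then show ?thesis
    by (subst openin_tuples_iff) (auto simp: has_extension_def)
qed

lemma dense_has_branching_refinement:
  assumes \<pi>: "locally_const \<pi>" and h: "h \<in> tuples"
  shows "nbhd h k \<inter> has_branching_refinement \<pi> \<noteq> {}"
proof -
  obtain l0 where l0: "l0 \<ge> k" "\<forall>y z. agree l0 y z \<longrightarrow> \<pi> y = \<pi> z"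
    using locally_constD[OF \<pi>] by blast
  obtain l where l: "l \<ge> l0" "\<And>i y z. i < m \<Longrightarrow> agree l y z \<Longrightarrow> agree k (h i y) (h i z)"
    using tuples_uniform[OF h] by metis
  obtain V and E :: "bool list cover edges" and \<delta> d where V: "total_graph m V E"
    "\<delta> ` V = range (prefix_of l)" "edge_map \<delta> E \<subseteq> induced m (prefix_of l) h"
    "\<And>p. p \<in> F \<Longrightarrow> d p \<in> V \<and> \<delta> (d p) = prefix_of l p \<and> (\<forall>i<m. (i, d p, d p) \<in> E)"
    "branching m (d ` F) E"
    using branching_cover[OF total_induced[OF h locally_const_prefix_of] F m, of "prefix_of l"]
      induced_mark[OF h] by (metis rangeI)
  obtain h' \<rho> where h': "h' \<in> nbhd h k" "locally_const \<rho>" "range \<rho> = V" "\<And>y. \<delta> (\<rho> y) = prefix_of l y"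
    "induced m \<rho> h' = E" "\<And>p. p \<in> F \<Longrightarrow> \<rho> p = d p"
    using realize[OF h le_trans[OF l0(1) l(1)] l(2) V(1-4)] by metis
  \<comment> \<open>The condition speaks of partitions labelled by numbers, so the finitely many
    vertices of the cover are numbered.\<close>
  obtain c :: "bool list cover \<Rightarrow> nat" where c: "inj_on c V"
    using finite_imp_inj_to_nat_seg V(1) unfolding total_graph_def by metis
  define f where "f = inv_into V c"
  have f: "f (c (\<rho> y)) = \<rho> y" for y
    unfolding f_def using c h'(3) by (auto intro: inv_into_f_f)
  have "branching m ((\<lambda>y. c (\<rho> y)) ` F) (induced m (\<lambda>y. c (\<rho> y)) h')"
  proof (rule branching_inj_pullback[where f = f and V = "range (\<lambda>y. c (\<rho> y))"])
    have "f ` (\<lambda>y. c (\<rho> y)) ` F = \<rho> ` F"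
      by (simp add: image_image f)
    also have "\<rho> ` F = d ` F"
      by (rule image_cong) (simp_all add: h'(6))
    finally have "f ` (\<lambda>y. c (\<rho> y)) ` F = d ` F" .
    moreover have "edge_map f (induced m (\<lambda>y. c (\<rho> y)) h') = E"
      using induced_comp[of m f "\<lambda>y. c (\<rho> y)" h'] h'(5) by (simp add: f)
    ultimately show "branching m (f ` (\<lambda>y. c (\<rho> y)) ` F) (edge_map f (induced m (\<lambda>y. c (\<rho> y)) h'))"
      using V(5) by simp
    show "inj_on f (range (\<lambda>y. c (\<rho> y)))" by (auto simp: inj_on_def f)
  qed (auto simp: induced_def)
  moreover have "\<pi> y = \<pi> z" if "c (\<rho> y) = c (\<rho> z)" for y z
  proof -
    have "prefix_of l y = prefix_of l z" using that f h'(4) by metis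
    then show ?thesis using l(1) l0(2) agree_mono unfolding prefix_of_eq_iff by blast
  qed
  moreover have "locally_const (\<lambda>y. c (\<rho> y))" using h'(2) by (rule locally_const_comp)
  moreover have "h' \<in> tuples" using h'(1) by (simp add: nbhd_def)
  ultimately have "h' \<in> has_branching_refinement \<pi>"
    by (intro has_branching_refinementI[of h' "\<lambda>y. c (\<rho> y)"])
  then show ?thesis using h'(1) by blast
qed

text \<open>When the guards hold, \<open>E\<close> and the graph of \<open>h\<close> on deep
  cylinders both lie over the branching graph of \<open>\<pi>\<close>. Their amalgam is realised
  near \<open>h\<close>; its first projection is the required extension, its second gives the
  closeness.\<close>

lemma dense_has_extension:
  assumes \<pi>: "locally_const \<pi>" and u: "locally_const u" and h: "h \<in> tuples"
  shows "nbhd h k \<inter> has_extension \<pi> u E \<noteq> {}"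
proof (cases "h \<in> has_extension \<pi> u E")
  case True
  then show ?thesis using h by (auto simp: nbhd_def)
next
  case False
  then obtain h0 where h0: "h0 \<in> tuples" "E = induced m u h0" and p: "\<And>p. p \<in> F \<Longrightarrow> coarsen (u p) = \<pi> p"
    and ind: "induced m \<pi> h = edge_map coarsen E" and br: "branching m (\<pi> ` F) (induced m \<pi> h)"
    using h unfolding has_extension_def by blast
  obtain l0 where l0: "l0 \<ge> k" "\<forall>y z. agree l0 y z \<longrightarrow> \<pi> y = \<pi> z"
    using locally_constD[OF \<pi>] by blast
  obtain l where l: "l \<ge> l0" "\<And>i y z. i < m \<Longrightarrow> agree l y z \<Longrightarrow> agree k (h i y) (h i z)"
    using tuples_uniform[OF h] by metis
  define \<psi> where "\<psi> = (\<lambda>w. \<pi> (inv (prefix_of l) w))"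
  have \<psi>: "\<psi> (prefix_of l y) = \<pi> y" for y
  proof -
    have "prefix_of l (inv (prefix_of l) (prefix_of l y)) = prefix_of l y"
      by (simp add: f_inv_into_f)
    then show ?thesis
      unfolding \<psi>_def prefix_of_eq_iff using l(1) l0(2) agree_mono by blast
  qed
  have hom: "edge_map coarsen (induced m u h0) \<subseteq> induced m \<pi> h" "edge_map \<psi> (induced m (prefix_of l) h) \<subseteq> induced m \<pi> h"
    using ind h0(2) induced_comp[of m \<psi> "prefix_of l" h] by (simp_all add: \<psi>)
  have onto: "coarsen ` range u = \<psi> ` range (prefix_of l)"
  proof -
    have "range (\<lambda>y. coarsen (u y)) = range \<pi>"
      using vertices_induced[OF m, of "\<lambda>y. coarsen (u y)" h0] vertices_induced[OF m, of \<pi> h]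
        ind h0(2) induced_comp[of m coarsen u h0] by simp
    then show ?thesis by (simp add: image_image \<psi>)
  qed
  have "coarsen ` u ` F = \<pi> ` F"
    using p by (auto simp: image_image)
  with br have br': "branching m (coarsen ` u ` F) (induced m \<pi> h)" by simp
  have mu: "u x \<in> range u \<and> (\<forall>i<m. (i, u x, u x) \<in> induced m u h0)" if "x \<in> F" for x
    using induced_mark[OF h0(1) that, where \<rho> = u] by simp
  have ml: "prefix_of l x \<in> range (prefix_of l) \<and>
      (\<forall>i<m. (i, prefix_of l x, prefix_of l x) \<in> induced m (prefix_of l) h) \<and> \<psi> (prefix_of l x) = coarsen (u x)"
    if "x \<in> F" for x
    using induced_mark[OF h that, where \<rho> = "prefix_of l"] p[OF that] \<psi> by simp
  obtain V E' where V: "total_graph m V E'" "\<forall>(b, c)\<in>V. coarsen b = \<psi> c"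
    "snd ` V = range (prefix_of l)" "edge_map fst E' = E" "edge_map snd E' \<subseteq> induced m (prefix_of l) h"
    "\<forall>p\<in>F. (u p, prefix_of l p) \<in> V \<and> (\<forall>i<m. (i, (u p, prefix_of l p), (u p, prefix_of l p)) \<in> E')"
    unfolding h0(2)
    by (rule amalgamation[OF total_induced[OF h0(1) u] total_induced[OF h locally_const_prefix_of[of l]]
          br' hom onto mu ml])
  obtain h' \<rho> where h': "h' \<in> nbhd h k" "locally_const \<rho>" "range \<rho> = V" "\<And>y. snd (\<rho> y) = prefix_of l y"
    "induced m \<rho> h' = E'" "\<And>p. p \<in> F \<Longrightarrow> \<rho> p = (u p, prefix_of l p)"
    by (rule realize[OF h le_trans[OF l0(1) l(1)] l(2) V(1,3,5), of "\<lambda>p. (u p, prefix_of l p)"])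
      (simp_all add: V(6))
  have "coarsen (fst (\<rho> y)) = \<pi> y" for y
  proof -
    have "\<rho> y \<in> V" using h'(3) by blast
    then have "coarsen (fst (\<rho> y)) = \<psi> (snd (\<rho> y))" using V(2) by (auto simp: case_prod_unfold)
    then show ?thesis using h'(4) \<psi> by simp
  qed
  moreover have "induced m (\<lambda>y. fst (\<rho> y)) h' = E"
    using induced_comp[of m fst \<rho> h'] h'(5) V(4) by simp
  moreover have "locally_const (\<lambda>y. fst (\<rho> y))" using h'(2) by (rule locally_const_comp)
  ultimately have "h' \<in> has_extension \<pi> u E"
    unfolding has_extension_def using h'(1,6) by (auto simp: nbhd_def intro!: exI[of _ "\<lambda>y. fst (\<rho> y)"])
  then show ?thesis using h'(1) by blast
qed

definition generic_set :: "(nat \<Rightarrow> (nat \<Rightarrow> bool) \<Rightarrow> nat \<Rightarrow> bool) set" where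
  "generic_set = {h \<in> tuples. \<forall>\<pi>. locally_const \<pi> \<longrightarrow> h \<in> has_branching_refinement \<pi> \<and>
     (\<forall>u E. locally_const u \<longrightarrow> finite E \<longrightarrow> h \<in> has_extension \<pi> u E)}"

lemma meagre_if_disjoint_generic:
  assumes S: "S \<subseteq> tuples" "S \<inter> generic_set = {}"
  shows "meagre_in tuples_top S"
proof (rule meagre_compl_INT)
  define LC where "LC = {\<rho> :: (nat \<Rightarrow> bool) \<Rightarrow> nat. locally_const \<rho>}"
  define I where "I = LC \<times> LC \<times> {E :: nat edges. finite E}"
  define U where "U = (\<lambda>(\<pi>, u, E). has_branching_refinement \<pi> \<inter> has_extension \<pi> u E)"
  show "countable I"
    unfolding I_def LC_def by (intro countable_SIGMA countable_locally_const countable_Collect_finite)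
  have "(\<lambda>_. 0, \<lambda>_. 0, {}) \<in> I"
    by (auto simp: I_def LC_def locally_const_def)
  then show "I \<noteq> {}" by blast
  show "openin tuples_top (U i)" if "i \<in> I" for i
    using that open_has_branching_refinement open_has_extension by (auto simp: I_def LC_def U_def)
  show "W \<inter> U i \<noteq> {}" if iW: "i \<in> I" "openin tuples_top W" "W \<noteq> {}" for i W
  proof -
    obtain \<pi> u E where i: "i = (\<pi>, u, E)" "locally_const \<pi>" "locally_const u"
      using iW(1) by (auto simp: I_def LC_def)
    have sub: "W' \<subseteq> tuples" if opn: "openin tuples_top W'" for W'
      using openin_subset[OF opn] unfolding topspace_tuples_top .
    obtain h k where "h \<in> W" "nbhd h k \<subseteq> W"
      using iW(2,3) openin_tuples_iff[OF sub[OF iW(2)]] by blast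
    then obtain h1 where h1: "h1 \<in> W \<inter> has_branching_refinement \<pi>"
      using dense_has_branching_refinement[OF i(2), of h k] sub[OF iW(2)] by blast
    \<comment> \<open>Openness of the first condition lets the density of the second be applied
      inside it.\<close>
    have "openin tuples_top (W \<inter> has_branching_refinement \<pi>)"
      using iW(2) open_has_branching_refinement by blast
    then obtain k' where "nbhd h1 k' \<subseteq> W \<inter> has_branching_refinement \<pi>"
      using h1 openin_tuples_iff[OF sub] by meson
    then show ?thesis
      using dense_has_extension[OF i(2,3), of h1 k' E] h1 sub[OF iW(2)] unfolding U_def i(1) by blast
  qed
  show "S \<subseteq> topspace tuples_top" using S unfolding topspace_tuples_top by blast
  have "\<Inter> (U ` I) \<inter> tuples \<subseteq> generic_set"
  proof
    fix h assume h: "h \<in> \<Inter> (U ` I) \<inter> tuples"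
    have "h \<in> has_branching_refinement \<pi> \<and> h \<in> has_extension \<pi> u E"
      if "locally_const \<pi>" "locally_const u" "finite E" for \<pi> u E
    proof -
      have "(\<pi>, u, E) \<in> I" using that by (simp add: I_def LC_def)
      then have "h \<in> U (\<pi>, u, E)" using h by blast
      then show ?thesis by (simp add: U_def)
    qed
    then show "h \<in> generic_set"
      using h unfolding generic_set_def by (auto intro: exI[of _ "\<lambda>_. 0"])
  qed
  then show "S \<inter> \<Inter> (U ` I) = {}" using S by blast
qed

section \<open>Back-and-forth between generic tuples\<close>

definition matching :: "(nat \<Rightarrow> (nat \<Rightarrow> bool) \<Rightarrow> nat \<Rightarrow> bool) \<Rightarrow> (nat \<Rightarrow> (nat \<Rightarrow> bool) \<Rightarrow> nat \<Rightarrow> bool) \<Rightarrow>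
    ((nat \<Rightarrow> bool) \<Rightarrow> nat) \<Rightarrow> ((nat \<Rightarrow> bool) \<Rightarrow> nat) \<Rightarrow> bool" where
  "matching h h' u v \<longleftrightarrow> locally_const u \<and> locally_const v \<and> (\<forall>p\<in>F. u p = v p) \<and>
     induced m u h = induced m v h' \<and> branching m (u ` F) (induced m u h)"

lemma matching_sym:
  assumes "matching h h' u v"
  shows "matching h' h v u"
proof -
  have "u ` F = v ` F"
    using assms by (intro image_cong) (auto simp: matching_def)
  then show ?thesis using assms unfolding matching_def by metis
qed

lemma matching_range:
  assumes "matching h h' u v"
  shows "range u = range v"
  using vertices_induced[OF m, of u h] vertices_induced[OF m, of v h'] assms by (simp add: matching_def)

text \<open>One side chooses a fine branching refinement, available by genericity of
  \<open>h\<close>; the other side copies its graph, by genericity of \<open>h'\<close>.\<close>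

lemma matching_forth:
  assumes h: "h \<in> generic_set" and h': "h' \<in> generic_set" and uv: "matching h h' u v"
  shows "\<exists>u' v'. matching h h' u' v' \<and> (\<forall>y. coarsen (u' y) = u y) \<and> (\<forall>y. coarsen (v' y) = v y) \<and> determines u' k"
proof -
  have u: "locally_const u" and v: "locally_const v" using uv by (auto simp: matching_def)
  have ht: "h \<in> tuples" using h by (simp add: generic_set_def)
  define \<pi> where "\<pi> = (\<lambda>y. to_nat (u y, prefix_of k y))"
  have "locally_const \<pi>"
    unfolding \<pi>_def by (rule locally_const_comp[OF locally_const_pair[OF u locally_const_prefix_of]])
  then have "h \<in> has_branching_refinement \<pi>"
    using h by (simp add: generic_set_def)
  then obtain \<rho> :: "(nat \<Rightarrow> bool) \<Rightarrow> nat" where \<rho>: "locally_const \<rho>" "\<And>y z. \<rho> y = \<rho> z \<Longrightarrow> \<pi> y = \<pi> z"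
    "branching m (\<rho> ` F) (induced m \<rho> h)"
    by (rule has_branching_refinementE) blast
  \<comment> \<open>Since \<rho> already refines \<open>u\<close>, the pairing leaves the cells as
    they are; it only makes \<open>coarsen\<close> return the old label.\<close>
  define u' where "u' = (\<lambda>y. prod_encode (u y, \<rho> y))"
  have u': "locally_const u'"
    unfolding u'_def by (rule locally_const_comp[OF locally_const_pair[OF u \<rho>(1)]])
  have co: "coarsen (u' y) = u y" and sn: "snd (prod_decode (u' y)) = \<rho> y" for y
    by (simp_all add: u'_def)
  have det: "u y = u z \<and> agree k y z" if "\<rho> y = \<rho> z" for y z
    using \<rho>(2)[OF that] by (simp add: \<pi>_def prefix_of_eq_iff)
  have br: "branching m (u' ` F) (induced m u' h)"
  proof (rule branching_inj_pullback[where f = "\<lambda>a. snd (prod_decode a)" and V = "range u'"])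
    show "branching m ((\<lambda>a. snd (prod_decode a)) ` u' ` F) (edge_map (\<lambda>a. snd (prod_decode a)) (induced m u' h))"
      using \<rho>(3) by (simp add: induced_comp[symmetric] image_image sn)
    show "inj_on (\<lambda>a. snd (prod_decode a)) (range u')"
    proof (rule inj_onI)
      fix a b assume "a \<in> range u'" "b \<in> range u'" and eq: "snd (prod_decode a) = snd (prod_decode b)"
      then obtain y z where yz: "a = u' y" "b = u' z" by blast
      then have "\<rho> y = \<rho> z" using eq sn by simp
      then show "a = b" using det[of y z] yz by (simp add: u'_def)
    qed
  qed (auto simp: induced_def)
  have fin: "finite (induced m u' h)"
    using total_induced[OF ht u'] finite_subset unfolding total_graph_def by (metis finite_SigmaI finite_lessThan)
  have "h' \<in> has_extension v u' (induced m u' h)"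
    using h' v u' fin by (simp add: generic_set_def)
  moreover have "\<forall>p\<in>F. coarsen (u' p) = v p"
    using uv by (simp add: co matching_def)
  moreover have "induced m v h' = edge_map coarsen (induced m u' h)"
    using uv by (simp add: induced_comp[symmetric] co matching_def)
  \<comment> \<open>The extension condition bites only over a branching graph; this is why
    \<open>matching\<close> carries \<open>branching\<close> along.\<close>
  moreover have "branching m (v ` F) (induced m v h')"
    using matching_sym[OF uv] unfolding matching_def by blast
  ultimately obtain v' where v': "locally_const v'" "\<forall>y. coarsen (v' y) = v y"
      "induced m v' h' = induced m u' h" "\<forall>p\<in>F. v' p = u' p"
    using ht unfolding has_extension_def by blast
  have "matching h h' u' v'"
    using u' v' br by (simp add: matching_def)
  moreover have "determines u' k"
    unfolding determines_def using det sn by metis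
  ultimately show ?thesis using co v'(2) by blast
qed

lemma matching_step:
  assumes "h \<in> generic_set" "h' \<in> generic_set" "matching h h' u v"
  shows "\<exists>u' v' \<phi>. matching h h' u' v' \<and> (\<forall>y. \<phi> (u' y) = u y) \<and> (\<forall>y. \<phi> (v' y) = v y) \<and>
    determines u' k \<and> determines v' k"
proof -
  obtain u1 v1 where 1: "matching h h' u1 v1" "\<And>y. coarsen (u1 y) = u y" "\<And>y. coarsen (v1 y) = v y" "determines u1 k"
    using matching_forth[OF assms] by metis
  obtain u2 v2 where 2: "matching h' h v2 u2" "\<And>y. coarsen (u2 y) = u1 y" "\<And>y. coarsen (v2 y) = v1 y" "determines v2 k"
    using matching_forth[OF assms(2,1) matching_sym[OF 1(1)]] by metis
  have "determines u2 k" using determines_mono[OF 1(4), of coarsen u2] 2(2) by blast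
  then show ?thesis
    using 1 2 matching_sym[OF 2(1)]
    by (intro exI[of _ u2] exI[of _ v2] exI[of _ "\<lambda>a. coarsen (coarsen a)"]) auto
qed

lemma generic_conjugate:
  assumes h: "h \<in> generic_set" and h': "h' \<in> generic_set"
  obtains g where "g \<in> fixing F" "\<And>i y. i < m \<Longrightarrow> h' i (g y) = g (h i y)"
proof -
  have ht: "h \<in> tuples" "h' \<in> tuples" using h h' by (auto simp: generic_set_def)
  \<comment> \<open>The one-cell partition gives every tuple the same graph, a vertex with
    \<open>m\<close> loops, in which all directions are unique. Amalgamating over it is joint
    embedding.\<close>
  let ?z = "\<lambda>_ :: nat \<Rightarrow> bool. 0 :: nat"
  have "branch_system m (?z ` F) (induced m ?z h) (\<lambda>_. dirs m)"
    by unfold_locales (auto simp: adj_def induced_def dirs_def split: if_splits)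
  then have start: "matching h h' ?z ?z"
    by (auto simp: matching_def locally_const_def induced_def branching_def)
  have P: "locally_const u \<and> locally_const v \<and> range u = range v \<and> (\<forall>p\<in>F. u p = v p)" if "matching h h' u v" for u v
    using that matching_range[OF that] by (simp add: matching_def)
  obtain g where g: "g \<in> fixing F" "\<forall>k. \<exists>u v. matching h h' u v \<and> determines u k \<and> (\<forall>y. v (g y) = u y)"
    by (rule back_and_forth[OF start P matching_step[OF h h']]) blast
  have "bij g" using g(1) Homeo_bij by (auto simp: fixing_def)
  have "h' i (g y) = g (h i y)" if i: "i < m" for i y
  proof -
    obtain w where w: "g w = h' i (g y)" using \<open>bij g\<close> by (metis bij_pointE)
    \<comment> \<open>As the graphs match, the cells of \<open>y\<close> and \<open>w\<close> are
      joined by an edge of \<open>h\<close>: some \<open>z\<close> in the cell of \<open>y\<close>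
      has its image in the cell of \<open>w\<close>. For fine cells this forces \<open>w\<close> and
      \<open>h i y\<close> to agree in \<open>k\<close> bits.\<close>
    have "agree k w (h i y)" for k
    proof -
      obtain l where l: "l \<ge> k" "\<And>i y z. i < m \<Longrightarrow> agree l y z \<Longrightarrow> agree k (h i y) (h i z)"
        using tuples_uniform[OF ht(1)] by metis
      obtain u v where uv: "matching h h' u v" "determines u l" "\<And>y. v (g y) = u y"
        using g(2) by metis
      have "(i, v (g y), v (h' i (g y))) \<in> induced m v h'"
        using i by (auto simp: induced_def)
      then have "(i, u y, u w) \<in> induced m u h"
        using uv(1,3) w by (metis matching_def)
      then obtain z where z: "u y = u z" "u w = u (h i z)" by (auto simp: induced_def)
      then have "agree l z y" "agree l w (h i z)"
        using uv(2) by (metis determines_def)+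
      then show ?thesis using l i agree_trans agree_mono by blast
    qed
    then show ?thesis using eq_if_agree_all w by metis
  qed
  then show ?thesis using that g(1) by blast
qed

section \<open>From conjugacy to comeagre orbits\<close>

lemma conj_orbit_subset:
  assumes "h \<in> tuples"
  shows "conj_orbit (fixing F) m h \<subseteq> tuples"
proof
  fix f assume "f \<in> conj_orbit (fixing F) m h"
  then obtain g where "g \<in> fixing F" and f: "f = (\<lambda>i\<in>{..<m}. inv g \<circ> h i \<circ> g)"
    unfolding conj_orbit_def by blast
  then have "inv g \<circ> h i \<circ> g \<in> fixing F" if "i < m" for i
    using that fixing_conj tuples_D[OF assms] by blast
  then show "f \<in> tuples" unfolding f by simp
qed

lemma generic_set_subset_conj_orbit:
  assumes "h \<in> generic_set"
  shows "generic_set \<subseteq> conj_orbit (fixing F) m h"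
proof
  fix f assume f: "f \<in> generic_set"
  \<comment> \<open>With \<open>f\<close> in first place, the equation rearranges to
    \<open>inv g \<circ> h i \<circ> g\<close>, the form used by \<open>conj_orbit\<close>.\<close>
  obtain g where g: "g \<in> fixing F" "\<And>i y. i < m \<Longrightarrow> h i (g y) = g (f i y)"
    using generic_conjugate[OF f assms] by blast
  have "inj g" using g(1) Homeo_bij by (auto simp: fixing_def bij_def)
  have "f = (\<lambda>i\<in>{..<m}. inv g \<circ> h i \<circ> g)"
  proof
    fix i
    show "f i = (\<lambda>i\<in>{..<m}. inv g \<circ> h i \<circ> g) i"
    proof (cases "i < m")
      case True
      then have "f i y = inv g (h i (g y))" for y
        using g(2) inv_f_f[OF \<open>inj g\<close>] by simp
      then have "f i = inv g \<circ> h i \<circ> g" by (intro ext) simp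
      then show ?thesis using True by simp
    next
      case False
      then show ?thesis using f by (simp add: generic_set_def PiE_def extensional_def)
    qed
  qed
  then show "f \<in> conj_orbit (fixing F) m h" using g(1) unfolding conj_orbit_def by blast
qed

text \<open>If \<open>generic_set\<close> is empty, then the whole space is meagre in itself and every orbit is
  trivially comeagre; so completeness of the group is not needed.\<close>
lemma generic_tuple_exists: "\<exists>h. generic_tuple (fixing F) (fixing_top F) m h"
proof -
  have "\<exists>h\<in>tuples. generic_set \<subseteq> conj_orbit (fixing F) m h"
  proof (cases "generic_set = {}")
    case True
    then show ?thesis
      using id_in_fixing by (intro bexI[of _ "\<lambda>i\<in>{..<m}. id"]) auto
  next
    case False
    then obtain h where "h \<in> generic_set" by blast
    moreover from this have "h \<in> tuples" by (simp add: generic_set_def)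
    ultimately show ?thesis using generic_set_subset_conj_orbit by blast
  qed
  then obtain h where h: "h \<in> tuples" "generic_set \<subseteq> conj_orbit (fixing F) m h" by blast
  then have "meagre_in tuples_top (tuples - conj_orbit (fixing F) m h)"
    by (intro meagre_if_disjoint_generic) auto
  then have "generic_tuple (fixing F) (fixing_top F) m h"
    using h(1) conj_orbit_subset[OF h(1)] by (simp add: generic_tuple_def comeagre_in_def topspace_tuples_top del: topspace_product_topology)
  then show ?thesis by blast
qed

end

text \<open>The space of empty tuples is a single point, which is its own orbit. The case stands
  apart because without relations a graph has no edges from which its vertices could be
  recovered.\<close>

lemma generic_tuple_0:
  assumes "G \<noteq> {}"
  shows "generic_tuple G T 0 (\<lambda>_. undefined)"
proof -
  let ?X = "product_topology (\<lambda>_. T) {..<0::nat}"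
  have "topspace ?X = conj_orbit G 0 (\<lambda>_. undefined)"
    using assms by (auto simp: conj_orbit_def restrict_def)
  moreover have "meagre_in ?X {}"
    by (auto simp: meagre_in_def nowhere_dense_in_def intro!: exI[of _ "\<lambda>_. {}"])
  ultimately show ?thesis
    by (auto simp: generic_tuple_def comeagre_in_def)
qed

theorem theorem1p2:
  fixes n :: nat and x :: "nat \<Rightarrow> (nat \<Rightarrow> bool)"
  assumes "inj_on x {1..n}"
  shows "ample_generics (Stab n x) (Stab_top n x)"
proof -
  let ?F = "x ` {1..n}"
  have "Stab n x = fixing ?F" by (auto simp: Stab_def fixing_def)
  moreover have "\<exists>h. generic_tuple (fixing ?F) (fixing_top ?F) m h" for m
  proof (cases "m = 0")
    case True
    then show ?thesis using generic_tuple_0 id_in_fixing by blast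
  next
    case False
    then interpret marked_tuples ?F m by unfold_locales auto
    show ?thesis by (rule generic_tuple_exists)
  qed
  ultimately show ?thesis by (simp add: ample_generics_def Stab_top_def)
qed

end
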